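(* Let $\epsilon\in[0,1)$, $\lambda,\mu>0$, $t_0^s\in\mathbb{R}$, and suppose the source alphabet and the channel-input alphabet coincide, $\mathcal{U}=\mathcal{V}$ with $|\mathcal{V}|=q\ge2$. Consider a source with message-generation rate $\lambda$ and starting time $t_0^s$, an erasure channel $q\mathrm{EC}(\epsilon)$ with channel-use rate $\mu$, and let $\rho=\lambda/\mu$. Let $\Delta_\epsilon$ be the optimal average age over $q\mathrm{EC}(\epsilon)$. (i) If $\rho$ is irrational, then $$\Delta_\epsilon=\frac{1}{2\lambda}+\frac{1+\epsilon}{2\mu(1-\epsilon)}.$$ (ii) If $\rho$ is rational, written in irreducible form as $\rho=c/d$ with $c,d$ positive integers and $\gcd(c,d)=1$, then $$\Delta_\epsilon=\frac{1}{2\lambda}+\frac{2\,[-d\lambda t_0^s]-1}{2d\lambda}+\frac{1+\epsilon}{2\mu(1-\epsilon)},$$ where $[x]=x-\lfloor x\rfloor$ denotes the fractional part of $x$.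
   Context: Put $T_s=1/\lambda$ and $T_c=1/\mu$. Channel: $q\mathrm{EC}(\epsilon)$ is the memoryless $q$-ary erasure channel with input alphabet $\mathcal{V}=\{0,\dots,q-1\}$ and output alphabet $\mathcal{V}\cup\{?\}$; each channel input is independently replaced by the erasure symbol $?$ with probability $\epsilon$ and otherwise received unchanged and instantaneously. There is no feedback. The $i$-th channel use ($i\ge1$) takes place at time $iT_c$. Source: a discrete memoryless source produces i.i.d. symbols $U_1,U_2,\dots\in\mathcal{U}$ (every letter of $\mathcal{U}$ having positive probability), independent of the erasures; $U_m$ is generated at time $mT_s+t_0^s$. Coding scheme: $\mathcal{C}=(f_i,g_i)_{i\ge1}$ where, with $M_i=\lfloor (iT_c-t_0^s)/T_s\rfloor$ (read as $0$ if negative), the encoder $f_i:\mathcal{U}^{M_i}\to\mathcal{V}$ produces the $i$-th channel input from $U_1,\dots,U_{M_i}$, and the decoder $g_i:(\mathcal{V}\cup\{?\})^i\to(\mathcal{U}\times\{1,\dots,M_i\})\cup\{\textsc{erasure}\}$ is applied to the first $i$ channel outputs. Decoders never err: if $g_i(Z_1,\dots,Z_i)=(\hat U,m)$ then $\hat U=U_m$ with probability 1. Age: for $t\in[iT_c,(i+1)T_c)$ the instantaneous age is $\Delta_{\epsilon,\mathcal{C}}(t)=t-mT_s-t_0^s$, where $m$ is the index output by the decoder at channel use $i$ ($m=0$ if the output is $\textsc{erasure}$ or if $i=0$). The average age is $\Delta_{\epsilon,\mathcal{C}}=\lim_{\tau\to\infty}\frac1\tau\int_0^\tau\Delta_{\epsilon,\mathcal{C}}(t)\,dt$,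 understood almost surely. The optimal average age is $\Delta_\epsilon=\inf_{\mathcal{C}}\Delta_{\epsilon,\mathcal{C}}$, the infimum being over all coding schemes for which this limit exists almost surely and is almost surely constant. *)

theory Defs
  imports "HOL-Probability.Probability"
begin

text \<open>
  Times are real numbers. Message \<open>m \<ge> 1\<close> is generated at time \<open>m / lam + t0\<close>, channel use
  \<open>i \<ge> 1\<close> takes place at time \<open>i / mu\<close>. Index \<open>0\<close> of the source process and of the erasure
  process is never used. The channel erasure symbol and the decoder output ERASURE are both
  represented by \<^const>\<open>None\<close>.
\<close>

definition memoryless_source :: "'w measure \<Rightarrow> 'u pmf \<Rightarrow> (nat \<Rightarrow> 'w \<Rightarrow> 'u) \<Rightarrow> bool" where
  "memoryless_source Pr p U \<longleftrightarrow>
     prob_space.indep_vars Pr (\<lambda>_. count_space UNIV) U {1..} \<and>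
     (\<forall>m\<ge>1. distr Pr (count_space UNIV) (U m) = measure_pmf p)"

text \<open>\<open>E i \<omega>\<close> states that the input of channel use \<open>i\<close> is erased.\<close>

definition erasure_process :: "'w measure \<Rightarrow> real \<Rightarrow> (nat \<Rightarrow> 'w \<Rightarrow> bool) \<Rightarrow> bool" where
  "erasure_process Pr \<epsilon> E \<longleftrightarrow>
     prob_space.indep_vars Pr (\<lambda>_. count_space UNIV) E {1..} \<and>
     (\<forall>i\<ge>1. measure Pr {\<omega> \<in> space Pr. E i \<omega>} = \<epsilon>)"

text \<open>
  The library's \<open>indep_var\<close> needs random variables of one common type, so independence of the two
  processes is stated as independence of the sigma-algebras they generate.
\<close>

definition independent_processes ::
  "'w measure \<Rightarrow> (nat \<Rightarrow> 'w \<Rightarrow> 'u) \<Rightarrow> (nat \<Rightarrow> 'w \<Rightarrow> 'v) \<Rightarrow> bool" where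
  "independent_processes Pr U E \<longleftrightarrow>
     prob_space.indep_set Pr
       (sets (vimage_algebra (space Pr) (\<lambda>\<omega>. \<lambda>m\<in>{1..}. U m \<omega>) (\<Pi>\<^sub>M m\<in>{1..}. count_space UNIV)))
       (sets (vimage_algebra (space Pr) (\<lambda>\<omega>. \<lambda>i\<in>{1..}. E i \<omega>) (\<Pi>\<^sub>M i\<in>{1..}. count_space UNIV)))"

text \<open>
  Number of messages generated up to channel use \<open>i\<close>; \<^const>\<open>nat\<close> turns negative values into \<open>0\<close>.
\<close>

definition num_messages :: "real \<Rightarrow> real \<Rightarrow> real \<Rightarrow> nat \<Rightarrow> nat" where
  "num_messages lam mu t0 i = nat \<lfloor>(real i * (1 / mu) - t0) / (1 / lam)\<rfloor>"

text \<open>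
  A coding scheme consists of encoders \<open>f\<close> and decoders \<open>g\<close>. Vectors are lists, so that the
  constraints on \<open>f i\<close> and \<open>g i\<close> concern only lists of the right length over the right alphabet.
\<close>

definition coding_scheme ::
  "'u set \<Rightarrow> nat \<Rightarrow> (nat \<Rightarrow> nat) \<Rightarrow> (nat \<Rightarrow> 'u list \<Rightarrow> nat) \<Rightarrow>
   (nat \<Rightarrow> nat option list \<Rightarrow> ('u \<times> nat) option) \<Rightarrow> bool" where
  "coding_scheme A q M f g \<longleftrightarrow>
     (\<forall>i\<ge>1.
       (\<forall>us. length us = M i \<and> set us \<subseteq> A \<longrightarrow> f i us \<in> {..<q}) \<and>
       (\<forall>zs. length zs = i \<and> set zs \<subseteq> insert None (Some ` {..<q}) \<longrightarrow>
             g i zs \<in> insert None (Some ` (A \<times> {1..M i}))))"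

definition channel_input ::
  "(nat \<Rightarrow> nat) \<Rightarrow> (nat \<Rightarrow> 'u list \<Rightarrow> nat) \<Rightarrow> (nat \<Rightarrow> 'w \<Rightarrow> 'u) \<Rightarrow> nat \<Rightarrow> 'w \<Rightarrow> nat" where
  "channel_input M f U i \<omega> = f i (map (\<lambda>m. U m \<omega>) [1..<Suc (M i)])"

definition channel_output ::
  "(nat \<Rightarrow> nat) \<Rightarrow> (nat \<Rightarrow> 'u list \<Rightarrow> nat) \<Rightarrow> (nat \<Rightarrow> 'w \<Rightarrow> 'u) \<Rightarrow> (nat \<Rightarrow> 'w \<Rightarrow> bool) \<Rightarrow>
   nat \<Rightarrow> 'w \<Rightarrow> nat option" where
  "channel_output M f U E i \<omega> = (if E i \<omega> then None else Some (channel_input M f U i \<omega>))"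

definition decoder_output ::
  "(nat \<Rightarrow> nat) \<Rightarrow> (nat \<Rightarrow> 'u list \<Rightarrow> nat) \<Rightarrow> (nat \<Rightarrow> nat option list \<Rightarrow> ('u \<times> nat) option) \<Rightarrow>
   (nat \<Rightarrow> 'w \<Rightarrow> 'u) \<Rightarrow> (nat \<Rightarrow> 'w \<Rightarrow> bool) \<Rightarrow> nat \<Rightarrow> 'w \<Rightarrow> ('u \<times> nat) option" where
  "decoder_output M f g U E i \<omega> = g i (map (\<lambda>j. channel_output M f U E j \<omega>) [1..<Suc i])"

definition never_errs ::
  "'w measure \<Rightarrow> (nat \<Rightarrow> nat) \<Rightarrow> (nat \<Rightarrow> 'u list \<Rightarrow> nat) \<Rightarrow>
   (nat \<Rightarrow> nat option list \<Rightarrow> ('u \<times> nat) option) \<Rightarrow>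
   (nat \<Rightarrow> 'w \<Rightarrow> 'u) \<Rightarrow> (nat \<Rightarrow> 'w \<Rightarrow> bool) \<Rightarrow> bool" where
  "never_errs Pr M f g U E \<longleftrightarrow>
     (\<forall>i\<ge>1. AE \<omega> in Pr. \<forall>u m. decoder_output M f g U E i \<omega> = Some (u, m) \<longrightarrow> u = U m \<omega>)"

definition decoded_index ::
  "(nat \<Rightarrow> nat) \<Rightarrow> (nat \<Rightarrow> 'u list \<Rightarrow> nat) \<Rightarrow> (nat \<Rightarrow> nat option list \<Rightarrow> ('u \<times> nat) option) \<Rightarrow>
   (nat \<Rightarrow> 'w \<Rightarrow> 'u) \<Rightarrow> (nat \<Rightarrow> 'w \<Rightarrow> bool) \<Rightarrow> nat \<Rightarrow> 'w \<Rightarrow> nat" where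
  "decoded_index M f g U E i \<omega> =
     (if i = 0 then 0
      else case decoder_output M f g U E i \<omega> of None \<Rightarrow> 0 | Some (u, m) \<Rightarrow> m)"

text \<open>
  For \<open>t \<ge> 0\<close>, the \<open>i\<close> with \<open>i / mu \<le> t < (i + 1) / mu\<close> is \<open>nat \<lfloor>t / (1 / mu)\<rfloor>\<close>.
\<close>

definition instantaneous_age ::
  "real \<Rightarrow> real \<Rightarrow> real \<Rightarrow> (nat \<Rightarrow> 'u list \<Rightarrow> nat) \<Rightarrow>
   (nat \<Rightarrow> nat option list \<Rightarrow> ('u \<times> nat) option) \<Rightarrow>
   (nat \<Rightarrow> 'w \<Rightarrow> 'u) \<Rightarrow> (nat \<Rightarrow> 'w \<Rightarrow> bool) \<Rightarrow> 'w \<Rightarrow> real \<Rightarrow> real" where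
  "instantaneous_age lam mu t0 f g U E \<omega> t =
     t - real (decoded_index (num_messages lam mu t0) f g U E (nat \<lfloor>t / (1 / mu)\<rfloor>) \<omega>) * (1 / lam) - t0"

text \<open>The time average of the age converges almost surely to the constant \<open>a\<close>.\<close>

definition has_average_age ::
  "'w measure \<Rightarrow> real \<Rightarrow> real \<Rightarrow> real \<Rightarrow> (nat \<Rightarrow> 'u list \<Rightarrow> nat) \<Rightarrow>
   (nat \<Rightarrow> nat option list \<Rightarrow> ('u \<times> nat) option) \<Rightarrow>
   (nat \<Rightarrow> 'w \<Rightarrow> 'u) \<Rightarrow> (nat \<Rightarrow> 'w \<Rightarrow> bool) \<Rightarrow> real \<Rightarrow> bool" where
  "has_average_age Pr lam mu t0 f g U E a \<longleftrightarrow>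
     (AE \<omega> in Pr.
       ((\<lambda>\<tau>. 1 / \<tau> * integral {0..\<tau>} (instantaneous_age lam mu t0 f g U E \<omega>)) \<longlongrightarrow> a) at_top)"

text \<open>
  The infimum is taken in the extended reals, where it is the genuine greatest lower bound also
  for an empty or unbounded set.
\<close>

definition optimal_average_age ::
  "'w measure \<Rightarrow> 'u set \<Rightarrow> nat \<Rightarrow> real \<Rightarrow> real \<Rightarrow> real \<Rightarrow>
   (nat \<Rightarrow> 'w \<Rightarrow> 'u) \<Rightarrow> (nat \<Rightarrow> 'w \<Rightarrow> bool) \<Rightarrow> ereal" where
  "optimal_average_age Pr A q lam mu t0 U E =
     Inf {ereal a | a f g.
            coding_scheme A q (num_messages lam mu t0) f g \<and>
            never_errs Pr (num_messages lam mu t0) f g U E \<and>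
            has_average_age Pr lam mu t0 f g U E a}"

end

theory Submission
  imports Defs "HOL-Analysis.Kronecker_Approximation_Theorem" "HOL-Library.Discrete_Functions"
begin

text \<open>
  At channel use \<open>i\<close> the decoder cannot know any message newer than the newest one available to the
  encoder at the last unerased use \<open>J \<le> i\<close>: altering only a later symbol has positive probability
  and leaves all channel outputs unchanged. As source and channel alphabets agree, sending the newest
  message uncoded attains this bound at all times. The age at channel use \<open>i\<close> is then
  \<open>(i - J) / mu\<close>, whose mean comes from a geometric law, plus the residual age
  \<open>frac (lam * (J / mu - t0)) / lam\<close>. The latter is averaged by Hermite's identity for rational
  \<open>\<rho>\<close>; for irrational \<open>\<rho>\<close> a Diophantine approximation \<open>\<bar>\<rho> - h / k\<bar> < 1 / k\<^sup>2\<close> makes every block of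
  \<open>k\<close> consecutive terms nearly a Hermite sum. Replacing the random \<open>J\<close> by its mean behaviour is a
  strong law for the martingale differences of the recursion \<open>X (i + 1) = X i + 1 / mu\<close> (erased) or
  \<open>X (i + 1) = \<psi> (i + 1)\<close> (unerased) satisfied by the age.
\<close>

section \<open>Means of fractional parts along arithmetic progressions\<close>

lemma frac_add_divide_nat:
  fixes k :: int and \<theta> :: real
  assumes "N > 0" "0 \<le> \<theta>" "\<theta> < 1"
  shows "frac ((of_int k + \<theta>) / real N) = (of_int (k mod int N) + \<theta>) / real N"
proof -
  have k: "real_of_int k = real N * of_int (k div int N) + of_int (k mod int N)"
    by (metis mult_div_mod_eq of_int_add of_int_mult of_int_of_nat_eq)
  have "k mod int N \<le> int N - 1"
    using pos_mod_bound[of "int N" k] assms(1) by linarith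
  then have "real_of_int (k mod int N) \<le> real N - 1"
    by linarith
  moreover have "0 \<le> k mod int N"
    using assms(1) by simp
  moreover have "(of_int k + \<theta>) / real N - (of_int (k mod int N) + \<theta>) / real N = of_int (k div int N)"
    using assms(1) by (subst k) (simp add: field_simps)
  ultimately show ?thesis
    using assms by (subst frac_unique_iff) (auto simp: divide_simps)
qed

text \<open>As \<open>p\<close> is a unit modulo \<open>N\<close>, it can be cancelled from
  \<open>(i - j) * p\<close>, and \<open>\<bar>i - j\<bar> < N\<close> leaves only
  \<open>i = j\<close>; an injective self-map of a finite set is onto.\<close>

lemma bij_betw_arith_progression_mod:
  fixes p a :: int
  assumes "N > 0" "coprime p (int N)"
  shows "bij_betw (\<lambda>j. nat ((a + int j * p) mod int N)) {..<N} {..<N}"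
proof -
  let ?r = "\<lambda>j. nat ((a + int j * p) mod int N)"
  have "?r ` {..<N} \<subseteq> {..<N}"
    using assms(1) by (auto simp: nat_less_iff)
  moreover have "inj_on ?r {..<N}"
  proof (rule inj_onI)
    fix i j assume ij: "i \<in> {..<N}" "j \<in> {..<N}" and "?r i = ?r j"
    then have "(a + int i * p) mod int N = (a + int j * p) mod int N"
      using assms(1) by (simp add: nat_eq_iff)
    then have "int N dvd (a + int i * p) - (a + int j * p)"
      by (simp add: mod_eq_dvd_iff)
    then have "int N dvd (int i - int j) * p"
      by (simp add: algebra_simps)
    then have "int N dvd int i - int j"
      using assms(2) by (simp add: coprime_commute coprime_dvd_mult_left_iff)
    moreover have "\<bar>int i - int j\<bar> < int N"
      using ij by auto
    ultimately show "i = j"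
      using zdvd_imp_le[of "int N" "\<bar>int i - int j\<bar>"] by force
  qed
  ultimately show ?thesis
    by (simp add: bij_betw_def endo_inj_surj)
qed

text \<open>Every term lies on the grid of step \<open>1 / N\<close> shifted by
  \<open>frac (N * y) / N\<close>. The shift is common to all \<open>j\<close>, which enters through
  an integer residue only.\<close>

lemma frac_arith_progression:
  fixes y :: real and p :: int
  assumes "N > 0"
  shows "frac (y + real j * of_int p / real N) =
    (real (nat ((\<lfloor>real N * y\<rfloor> + int j * p) mod int N)) + frac (real N * y)) / real N"
proof -
  have "y + real j * of_int p / real N =
      (of_int (\<lfloor>real N * y\<rfloor> + int j * p) + frac (real N * y)) / real N"
    using assms by (simp add: frac_def field_simps)
  then show ?thesis
    using assms frac_add_divide_nat[of N "frac (real N * y)" "\<lfloor>real N * y\<rfloor> + int j * p"]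
    by (simp add: frac_lt_1 del: of_int_add of_int_mult)
qed

lemma sum_of_nat_lessThan: "(\<Sum>r<N. real r) = real N * (real N - 1) / 2"
  by (induction N) (auto simp: field_simps)

text \<open>Hermite's identity: the residues are a permutation of \<open>0, ..., N - 1\<close>, so
  neither \<open>p\<close> nor the order of the terms survives in the sum.\<close>

lemma sum_frac_arith_progression:
  fixes y :: real and p :: int
  assumes "N > 0" "coprime p (int N)"
  shows "(\<Sum>j<N. frac (y + real j * of_int p / real N)) = (real N - 1) / 2 + frac (real N * y)"
proof -
  let ?r = "\<lambda>j. nat ((\<lfloor>real N * y\<rfloor> + int j * p) mod int N)"
  have "(\<Sum>j<N. frac (y + real j * of_int p / real N)) =
      (\<Sum>j<N. (real (?r j) + frac (real N * y)) / real N)"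
    using assms(1) by (simp add: frac_arith_progression)
  also have "\<dots> = (\<Sum>r<N. (real r + frac (real N * y)) / real N)"
    using bij_betw_arith_progression_mod[OF assms] by (rule sum.reindex_bij_betw)
  also have "\<dots> = ((\<Sum>r<N. real r) + real N * frac (real N * y)) / real N"
    by (simp add: sum_divide_distrib[symmetric] sum.distrib)
  also have "\<dots> = (real N - 1) / 2 + frac (real N * y)"
    unfolding sum_of_nat_lessThan using assms(1) by (simp add: field_simps)
  finally show ?thesis .
qed

section \<open>Irrational steps compared with a nearby rational step\<close>

lemma abs_frac_diff_le:
  fixes z w \<delta> :: real
  assumes "\<bar>w - z\<bar> \<le> \<delta>" "\<delta> \<le> frac z" "frac z < 1 - \<delta>"
  shows "\<bar>frac w - frac z\<bar> \<le> \<delta>"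
proof -
  have "frac w = frac z + (w - z)"
    unfolding frac_unique_iff using assms by (auto simp: frac_def)
  then show ?thesis using assms(1) by simp
qed

text \<open>Within one block the step error adds up to at most \<open>N * (1 / N^2) = 1 / N\<close>,
  so each fractional part moves by at most \<open>1 / N\<close> unless an integer lies within reach.
  That needs residue \<open>0\<close> or \<open>N - 1\<close>, and each residue occurs once. The
  total is at most \<open>N * (1 / N) + 2 = 3\<close>, and passing from the Hermite sum to
  \<open>N / 2\<close> costs at most \<open>1 / 2\<close> more.\<close>

lemma sum_frac_near_arith_progression:
  fixes y \<rho> :: real and p :: int
  assumes "N > 0" "coprime p (int N)" "\<bar>\<rho> - of_int p / real N\<bar> \<le> 1 / (real N)\<^sup>2"
  shows "\<bar>(\<Sum>j<N. frac (y + real j * \<rho>)) - real N / 2\<bar> \<le> 4"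
proof -
  let ?r = "\<lambda>j. nat ((\<lfloor>real N * y\<rfloor> + int j * p) mod int N)"
  let ?z = "\<lambda>j. y + real j * of_int p / real N"
  let ?G = "\<lambda>r. 1 / real N + (if r = 0 \<or> r = N - 1 then 1 else (0::real))"
  have "\<bar>frac (y + real j * \<rho>) - frac (?z j)\<bar> \<le> ?G (?r j)" if "j < N" for j
  proof (cases "?r j = 0 \<or> ?r j = N - 1")
    case True
    have "\<bar>frac (y + real j * \<rho>) - frac (?z j)\<bar> \<le> 1"
      using frac_ge_0[of "?z j"] frac_lt_1[of "?z j"]
        frac_ge_0[of "y + real j * \<rho>"] frac_lt_1[of "y + real j * \<rho>"] by linarith
    also have "1 \<le> ?G (?r j)"
      unfolding if_P[OF True] by simp
    finally show ?thesis .
  next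
    case False
    have "?r j < N"
      using assms(1) by (simp add: nat_less_iff)
    with False have r: "1 \<le> real (?r j)" "real (?r j) + 2 \<le> real N"
      by linarith+
    have fr: "frac (?z j) = (real (?r j) + frac (real N * y)) / real N"
      using assms(1) by (rule frac_arith_progression)
    have "(y + real j * \<rho>) - ?z j = real j * (\<rho> - of_int p / real N)"
      by (simp add: right_diff_distrib)
    then have "\<bar>(y + real j * \<rho>) - ?z j\<bar> = real j * \<bar>\<rho> - of_int p / real N\<bar>"
      by (simp add: abs_mult)
    also have "\<dots> \<le> real N * (1 / (real N)\<^sup>2)"
      using that assms(3) by (intro mult_mono) auto
    finally have "\<bar>(y + real j * \<rho>) - ?z j\<bar> \<le> 1 / real N"
      using assms(1) by (simp add: power2_eq_square)
    moreover have "1 / real N \<le> frac (?z j)"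
      unfolding fr using r(1) frac_ge_0[of "real N * y"]
      by (intro divide_right_mono) linarith+
    moreover have "frac (?z j) < 1 - 1 / real N"
    proof -
      have "frac (?z j) < (real N - 1) / real N"
        unfolding fr using r(2) frac_lt_1[of "real N * y"] assms(1)
        by (intro divide_strict_right_mono) linarith+
      then show ?thesis using assms(1) by (simp add: diff_divide_distrib)
    qed
    ultimately show ?thesis
      using False abs_frac_diff_le by simp
  qed
  then have "\<bar>\<Sum>j<N. frac (y + real j * \<rho>) - frac (?z j)\<bar> \<le> (\<Sum>j<N. ?G (?r j))"
    by (intro order_trans[OF sum_abs] sum_mono) simp
  also have "\<dots> = (\<Sum>r<N. ?G r)"
    using bij_betw_arith_progression_mod[OF assms(1,2)] by (rule sum.reindex_bij_betw)
  also have "\<dots> = 1 + real (card {r \<in> {..<N}. r = 0 \<or> r = N - 1})"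
    using assms(1) by (simp add: sum.distrib sum.If_cases Collect_conj_eq lessThan_def)
  \<comment> \<open>For \<open>N = 1\<close> the two exceptional residues coincide, hence only an
    upper bound.\<close>
  also have "card {r \<in> {..<N}. r = 0 \<or> r = N - 1} \<le> card {0, N - 1}"
    by (rule card_mono) auto
  also have "\<dots> \<le> 2"
    by (simp add: card_insert_if)
  finally have "\<bar>(\<Sum>j<N. frac (y + real j * \<rho>)) - (\<Sum>j<N. frac (?z j))\<bar> \<le> 3"
    by (simp add: sum_subtractf)
  moreover have "(\<Sum>j<N. frac (?z j)) = (real N - 1) / 2 + frac (real N * y)"
    using assms(1,2) by (rule sum_frac_arith_progression)
  moreover have "\<bar>a - n / 2\<bar> \<le> 4" if "\<bar>a - b\<bar> \<le> 3" "b = (n - 1) / 2 + t" "0 \<le> t" "t < 1"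
    for a b n t :: real
    using that unfolding abs_le_iff by (auto simp: field_simps)
  ultimately show ?thesis
    using frac_ge_0 frac_lt_1 by blast
qed

section \<open>Cesaro means from block sums\<close>

lemma sum_blocks:
  fixes f :: "nat \<Rightarrow> 'a::comm_monoid_add"
  shows "(\<Sum>j<m * N. f j) = (\<Sum>b<m. \<Sum>j<N. f (b * N + j))"
proof (induction m)
  case (Suc m)
  have "{..<Suc m * N} = {..<m * N} \<union> {m * N..<m * N + N}" by auto
  then have "sum f {..<Suc m * N} = sum f {..<m * N} + sum f {m * N..<m * N + N}"
    by (simp add: sum.union_disjoint ivl_disj_int)
  also have "sum f {m * N..<m * N + N} = (\<Sum>j<N. f (m * N + j))"
    using sum.shift_bounds_nat_ivl[of f 0 "m * N" N]
    by (simp add: add.commute lessThan_atLeast0)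
  finally show ?case using Suc by simp
qed simp

text \<open>Cut the \<open>n\<close> terms into full blocks, at most \<open>n / N\<close> of them
  with error \<open>C\<close> each, and a tail of fewer than \<open>N\<close> terms with error
  \<open>B\<close> each.\<close>

lemma block_mean_bound:
  fixes f :: "nat \<Rightarrow> real"
  assumes "N > 0" "\<And>j. \<bar>f j - \<kappa>\<bar> \<le> B"
    and block: "\<And>b. \<bar>(\<Sum>j<N. f (b + j)) - real N * \<kappa>\<bar> \<le> C"
  shows "\<bar>(\<Sum>j<n. f j) - real n * \<kappa>\<bar> \<le> real n * C / real N + real N * B"
proof -
  let ?h = "\<lambda>j. f j - \<kappa>"
  have C: "C \<ge> 0" and B: "B \<ge> 0"
    using block[of 0] assms(2)[of 0] by linarith+
  have "\<bar>\<Sum>j<n div N * N. ?h j\<bar> = \<bar>\<Sum>b<n div N. (\<Sum>j<N. f (b * N + j)) - real N * \<kappa>\<bar>"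
    by (simp add: sum_blocks sum_subtractf)
  also have "\<dots> \<le> real (n div N) * C"
    by (rule order_trans[OF sum_abs], rule order_trans[OF sum_mono[OF block]]) simp
  also have "\<dots> \<le> real n * C / real N"
    using mult_right_mono[OF of_nat_div_le_of_nat[of n N] C] by simp
  finally have 1: "\<bar>\<Sum>j<n div N * N. ?h j\<bar> \<le> real n * C / real N" .
  have "\<bar>\<Sum>j=n div N * N..<n. ?h j\<bar> \<le> real (n - n div N * N) * B"
    by (rule order_trans[OF sum_abs], rule order_trans[OF sum_mono[OF assms(2)]]) simp
  also have "n - n div N * N \<le> N"
    using assms(1) by (simp add: minus_div_mult_eq_mod)
  then have "real (n - n div N * N) * B \<le> real N * B"
    using B by (intro mult_right_mono of_nat_mono)
  finally have 2: "\<bar>\<Sum>j=n div N * N..<n. ?h j\<bar> \<le> real N * B" .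
  have "(\<Sum>j<n. ?h j) = (\<Sum>j<n div N * N. ?h j) + (\<Sum>j=n div N * N..<n. ?h j)"
    by (simp add: lessThan_atLeast0 sum.atLeastLessThan_concat)
  with 1 2 show ?thesis
    by (simp add: sum_subtractf)
qed

text \<open>The relative block error is uniform in the position \<open>b\<close>. Choosing
  \<open>N\<close> for half the tolerance first makes the tail error \<open>N * B\<close> a
  constant, which a large \<open>n\<close> absorbs.\<close>

lemma block_mean_tendsto:
  fixes f :: "nat \<Rightarrow> real"
  assumes bdd: "\<And>j. \<bar>f j - \<kappa>\<bar> \<le> B"
    and block: "\<And>e. e > 0 \<Longrightarrow> \<exists>N C. N > 0 \<and> C \<le> e * real N \<and>
        (\<forall>b. \<bar>(\<Sum>j<N. f (b + j)) - real N * \<kappa>\<bar> \<le> C)"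
  shows "(\<lambda>n. (\<Sum>j<n. f j) / real n) \<longlonglongrightarrow> \<kappa>"
proof (rule LIMSEQ_I)
  fix r :: real assume "0 < r"
  then obtain N C where N: "N > 0" "C \<le> r / 2 * real N"
    and b: "\<And>b. \<bar>(\<Sum>j<N. f (b + j)) - real N * \<kappa>\<bar> \<le> C"
    using block[of "r / 2"] by (meson half_gt_zero)
  obtain n0 :: nat where n0: "real N * B / (r / 2) < real n0"
    using reals_Archimedean2 by blast
  show "\<exists>no. \<forall>n\<ge>no. norm ((\<Sum>j<n. f j) / real n - \<kappa>) < r"
  proof (intro exI allI impI)
    fix n assume n: "n \<ge> Suc n0"
    have "\<bar>(\<Sum>j<n. f j) - real n * \<kappa>\<bar> \<le> real n * (C / real N) + real N * B"
      using block_mean_bound[OF N(1) bdd b, of n] by simp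
    also have "C / real N \<le> r / 2"
      using N by (simp add: field_simps)
    then have "real n * (C / real N) \<le> real n * (r / 2)"
      by (intro mult_left_mono) auto
    also have "real N * B < real n * (r / 2)"
    proof -
      have "real N * B < real n0 * (r / 2)" using n0 \<open>0 < r\<close> by (simp add: field_simps)
      also have "\<dots> \<le> real n * (r / 2)" using n \<open>0 < r\<close> by (intro mult_right_mono) auto
      finally show ?thesis .
    qed
    finally have "\<bar>(\<Sum>j<n. f j) - real n * \<kappa>\<bar> < r * real n"
      by (simp add: mult.commute)
    moreover have "(\<Sum>j<n. f j) / real n - \<kappa> = ((\<Sum>j<n. f j) - real n * \<kappa>) / real n"
      using n by (simp add: field_simps)
    ultimately show "norm ((\<Sum>j<n. f j) / real n - \<kappa>) < r"
      using n by (simp add: pos_divide_less_eq)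
  qed
qed

text \<open>An irrational number has infinitely many approximations \<open>h / k\<close>, hence
  arbitrarily large \<open>k\<close>; the block error \<open>4\<close> is below \<open>e * k\<close>
  once \<open>k > 4 / e\<close>.\<close>

lemma frac_mean_irrational:
  assumes "\<rho> \<notin> \<rat>"
  shows "(\<lambda>n. (\<Sum>j<n. frac (x + real j * \<rho>)) / real n) \<longlonglongrightarrow> 1 / 2"
proof (rule block_mean_tendsto)
  show "\<bar>frac (x + real j * \<rho>) - 1 / 2\<bar> \<le> 1" for j
    using frac_ge_0[of "x + real j * \<rho>"] frac_lt_1[of "x + real j * \<rho>"] by linarith
  fix e :: real assume "e > 0"
  have "infinite (approx_set \<rho>)"
    using assms rational_iff_finite_approx_set by blast
  then obtain h k where hk: "(h, k) \<in> approx_set \<rho>" "k > \<lceil>4 / e\<rceil>"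
    using infinite_approx_set by blast
  then have k: "k > 0" "coprime h k" "\<bar>\<rho> - of_int h / of_int k\<bar> < 1 / (of_int k)\<^sup>2"
    by (auto simp: approx_set_def)
  define N where "N = nat k"
  have N: "N > 0" "int N = k" "real N = of_int k"
    using k(1) by (auto simp: N_def)
  have "4 / e < real N"
    using hk(2) N(3) by linarith
  then have "4 \<le> e * real N"
    using \<open>e > 0\<close> by (simp add: field_simps)
  moreover have "\<bar>(\<Sum>j<N. frac (x + real (b + j) * \<rho>)) - real N * (1 / 2)\<bar> \<le> 4" for b
    using sum_frac_near_arith_progression[of N h \<rho> "x + real b * \<rho>"] N k
    by (simp add: algebra_simps)
  ultimately show "\<exists>N C. N > 0 \<and> C \<le> e * real N \<and>
      (\<forall>b. \<bar>(\<Sum>j<N. frac (x + real (b + j) * \<rho>)) - real N * (1 / 2)\<bar> \<le> C)"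
    using N(1) by blast
qed

lemma frac_mean_rational:
  assumes "d > 0" "coprime c d"
  shows "(\<lambda>n. (\<Sum>j<n. frac (x + real j * (real c / real d))) / real n)
    \<longlonglongrightarrow> 1 / 2 + (2 * frac (real d * x) - 1) / (2 * real d)" (is "_ \<longlonglongrightarrow> ?\<kappa>")
proof (rule block_mean_tendsto)
  let ?f = "\<lambda>j. frac (x + real j * (real c / real d))"
  show "\<bar>?f j - ?\<kappa>\<bar> \<le> 1 + \<bar>?\<kappa>\<bar>" for j
    using frac_ge_0[of "x + real j * (real c / real d)"] frac_lt_1[of "x + real j * (real c / real d)"]
    by linarith
  fix e :: real assume "e > 0"
  have "(\<Sum>j<d. ?f (b + j)) = real d * ?\<kappa>" for b
  proof -
    have "(\<Sum>j<d. ?f (b + j)) =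
        (\<Sum>j<d. frac ((x + real b * (real c / real d)) + real j * of_int (int c) / real d))"
      by (simp add: algebra_simps add_divide_distrib)
    also have "\<dots> = (real d - 1) / 2 + frac (real d * (x + real b * (real c / real d)))"
      using assms by (intro sum_frac_arith_progression) (auto simp: coprime_int_iff)
    \<comment> \<open>Moving the block by \<open>b\<close> shifts the argument by the integer
      \<open>b * c\<close>, so all blocks of length \<open>d\<close> have the same exact sum and
      \<open>C = 0\<close> works.\<close>
    also have "real d * (x + real b * (real c / real d)) = real d * x + of_int (int (b * c))"
      using assms by (simp add: field_simps)
    also have "frac \<dots> = frac (real d * x)"
      by (rule frac_add_of_int_right)
    also have "(real d - 1) / 2 + frac (real d * x) = real d * ?\<kappa>"
      using assms(1) by (simp add: field_simps)
    finally show ?thesis .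
  qed
  then show "\<exists>N C. N > 0 \<and> C \<le> e * real N \<and> (\<forall>b. \<bar>(\<Sum>j<N. ?f (b + j)) - real N * ?\<kappa>\<bar> \<le> C)"
    using assms(1) \<open>e > 0\<close> by (intro exI[of _ d] exI[of _ 0]) auto
qed

section \<open>A strong law for orthogonal random variables\<close>

text \<open>Tonelli: the integral of the series is the sum of the integrals, so the series is finite
  almost everywhere and its terms vanish in the limit.\<close>

lemma AE_tendsto_zero_if_summable_integral:
  fixes f :: "nat \<Rightarrow> 'a \<Rightarrow> real"
  assumes [measurable]: "\<And>n. integrable M (f n)" and nonneg: "\<And>n x. 0 \<le> f n x"
    and "summable (\<lambda>n. integral\<^sup>L M (f n))"
  shows "AE x in M. (\<lambda>n. f n x) \<longlonglongrightarrow> 0"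
proof -
  have [measurable]: "f n \<in> borel_measurable M" for n
    using assms(1) by auto
  have "(\<integral>\<^sup>+x. (\<Sum>n. ennreal (f n x)) \<partial>M) = (\<Sum>n. \<integral>\<^sup>+x. ennreal (f n x) \<partial>M)"
    by (rule nn_integral_suminf) measurable
  also have "\<dots> = (\<Sum>n. ennreal (integral\<^sup>L M (f n)))"
    using assms(1) nonneg by (intro suminf_cong nn_integral_eq_integral) auto
  also have "\<dots> = ennreal (\<Sum>n. integral\<^sup>L M (f n))"
    using assms(3) nonneg by (intro suminf_ennreal2) auto
  finally have "(\<integral>\<^sup>+x. (\<Sum>n. ennreal (f n x)) \<partial>M) \<noteq> \<infinity>"
    by simp
  then have "AE x in M. (\<Sum>n. ennreal (f n x)) \<noteq> \<infinity>"
    by (intro nn_integral_PInf_AE) measurable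
  then show ?thesis
  proof eventually_elim
    case (elim x)
    then have "summable (\<lambda>n. f n x)"
      using nonneg by (intro summable_suminf_not_top) auto
    then show ?case
      by (rule summable_LIMSEQ_zero)
  qed
qed

lemma filterlim_floor_sqrt_at_top: "filterlim floor_sqrt at_top at_top"
  unfolding filterlim_at_top
proof
  fix Z show "\<forall>\<^sub>F x in at_top. Z \<le> floor_sqrt x"
    using eventually_ge_at_top[of "Z\<^sup>2"] by eventually_elim (rule le_floor_sqrtI)
qed

text \<open>Split at \<open>n^2\<close>, use \<open>(a + b)^2 \<le> 2 a^2 + 2 b^2\<close>, and apply
  Cauchy--Schwarz to the at most \<open>2 n + 1\<close> remaining terms. The right-hand side is the
  same for all \<open>k\<close> between the two squares.\<close>

lemma square_sum_le:
  fixes D :: "nat \<Rightarrow> real"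
  assumes "n\<^sup>2 \<le> k" "k < (Suc n)\<^sup>2"
  shows "(\<Sum>i<k. D i)\<^sup>2 \<le>
    2 * (\<Sum>i<n\<^sup>2. D i)\<^sup>2 + 2 * (real (2 * n + 1) * (\<Sum>i\<in>{n\<^sup>2..<(Suc n)\<^sup>2}. (D i)\<^sup>2))"
proof -
  let ?a = "\<Sum>i<n\<^sup>2. D i" and ?b = "\<Sum>i\<in>{n\<^sup>2..<k}. D i"
  have "(\<Sum>i<k. D i) = ?a + ?b"
    using assms(1) by (simp add: lessThan_atLeast0 sum.atLeastLessThan_concat)
  moreover have "(?a + ?b)\<^sup>2 \<le> 2 * ?a\<^sup>2 + 2 * ?b\<^sup>2"
    using sum_squares_bound[of ?a ?b] by (simp add: power2_sum)
  moreover have "?b\<^sup>2 \<le> (\<Sum>i\<in>{n\<^sup>2..<k}. (D i)\<^sup>2) * real (card {n\<^sup>2..<k})"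
    by (rule sum_squared_le_sum_of_squares)
  moreover have "\<dots> \<le> (\<Sum>i\<in>{n\<^sup>2..<(Suc n)\<^sup>2}. (D i)\<^sup>2) * real (2 * n + 1)"
  proof (rule mult_mono)
    have "card {n\<^sup>2..<k} \<le> 2 * n + 1"
      using assms(2) by (simp add: power2_eq_square)
    then show "real (card {n\<^sup>2..<k}) \<le> real (2 * n + 1)"
      by linarith
  qed (use assms in \<open>auto intro!: sum_mono2 sum_nonneg\<close>)
  ultimately show ?thesis
    by (simp add: mult.commute)
qed

text \<open>Along the squares the second moments of the means are summable; the gaps between consecutive
  squares are short enough to be controlled by Cauchy--Schwarz.\<close>

lemma slln_orthogonal:
  fixes D :: "nat \<Rightarrow> 'a \<Rightarrow> real"
  assumes int: "\<And>i j. integrable M (\<lambda>x. D i x * D j x)"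
    and orth: "\<And>i j. i < j \<Longrightarrow> (\<integral>x. D i x * D j x \<partial>M) = 0"
    and bound: "\<And>i. (\<integral>x. (D i x)\<^sup>2 \<partial>M) \<le> C"
  shows "AE x in M. (\<lambda>n. (\<Sum>i<n. D i x) / real n) \<longlonglongrightarrow> 0"
proof -
  \<comment> \<open>A majorant of the squared mean for every \<open>k\<close> from
    \<open>n^2\<close> up to the next square, since then \<open>k^2 \<ge> n^4\<close>. Its integral
    is of order \<open>1 / n^2\<close>.\<close>
  let ?F = "\<lambda>n x. (2 * (\<Sum>i<n\<^sup>2. D i x)\<^sup>2
      + 2 * (real (2 * n + 1) * (\<Sum>i\<in>{n\<^sup>2..<(Suc n)\<^sup>2}. (D i x)\<^sup>2))) / real n ^ 4"
  have int2: "integrable M (\<lambda>x. (D i x)\<^sup>2)" for i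
    using int[of i i] by (simp add: power2_eq_square)
  have sq: "(\<Sum>i<n. D i x)\<^sup>2 = (\<Sum>i<n. \<Sum>j<n. D i x * D j x)" for n x
    by (simp add: power2_eq_square sum_product)
  have intS: "integrable M (\<lambda>x. (\<Sum>i<n. D i x)\<^sup>2)" for n
    unfolding sq by (intro Bochner_Integration.integrable_sum int)
  have orth': "(\<integral>x. D i x * D j x \<partial>M) = (if i = j then \<integral>x. (D i x)\<^sup>2 \<partial>M else 0)" for i j
    using orth[of i j] orth[of j i] by (cases i j rule: linorder_cases) (auto simp: mult.commute power2_eq_square)
  have S: "(\<integral>x. (\<Sum>i<n. D i x)\<^sup>2 \<partial>M) \<le> real n * C" for n
  proof -
    have "(\<integral>x. (\<Sum>i<n. D i x)\<^sup>2 \<partial>M) = (\<Sum>i<n. \<Sum>j<n. \<integral>x. D i x * D j x \<partial>M)"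
      unfolding sq using int by (simp add: Bochner_Integration.integral_sum)
    also have "\<dots> = (\<Sum>i<n. \<integral>x. (D i x)\<^sup>2 \<partial>M)"
      unfolding orth' by simp
    also have "\<dots> \<le> (\<Sum>i<n. C)"
      by (intro sum_mono bound)
    finally show ?thesis by simp
  qed
  have C: "C \<ge> 0"
    using bound[of 0] by (rule order_trans[rotated]) simp
  have intF: "integrable M (?F n)" for n
    by (intro integrable_divide Bochner_Integration.integrable_add integrable_mult_right
        Bochner_Integration.integrable_sum intS int2)
  have boundF: "integral\<^sup>L M (?F n) \<le> 20 * C * inverse ((real n)\<^sup>2)" for n
  \<comment> \<open>For \<open>n = 0\<close> both sides are \<open>0\<close>, division by zero being
    \<open>0\<close>.\<close>
  proof (cases "n = 0")
    case False
    have card: "card {n\<^sup>2..<(Suc n)\<^sup>2} = 2 * n + 1"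
      by (simp add: power2_eq_square)
    have G: "(\<Sum>i\<in>{n\<^sup>2..<(Suc n)\<^sup>2}. \<integral>x. (D i x)\<^sup>2 \<partial>M) \<le> real (2 * n + 1) * C"
      by (rule order_trans[OF sum_mono[OF bound]]) (simp only: sum_constant card order_refl)
    have "integral\<^sup>L M (?F n) = (2 * (\<integral>x. (\<Sum>i<n\<^sup>2. D i x)\<^sup>2 \<partial>M)
        + 2 * (real (2 * n + 1) * (\<Sum>i\<in>{n\<^sup>2..<(Suc n)\<^sup>2}. \<integral>x. (D i x)\<^sup>2 \<partial>M))) / real n ^ 4"
      by (simp add: intS int2 Bochner_Integration.integral_sum)
    also have "\<dots> \<le> (2 * (real (n\<^sup>2) * C) + 2 * (real (2 * n + 1) * (real (2 * n + 1) * C))) / real n ^ 4"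
      using S[of "n\<^sup>2"] G
      by (intro divide_right_mono add_mono mult_left_mono) auto
    also have "\<dots> = (2 * (real n)\<^sup>2 + 2 * (2 * real n + 1)\<^sup>2) * C / real n ^ 4"
      by (simp add: algebra_simps power2_eq_square)
    \<comment> \<open>\<open>2 n + 1 \<le> 3 n\<close> for \<open>n \<ge> 1\<close>; the constant is
      \<open>20 = 2 + 2 * 9\<close>.\<close>
    also have "\<dots> \<le> (2 * (real n)\<^sup>2 + 2 * (3 * real n)\<^sup>2) * C / real n ^ 4"
      using False C by (intro divide_right_mono mult_right_mono add_left_mono mult_left_mono power_mono) auto
    also have "\<dots> = 20 * C * inverse ((real n)\<^sup>2)"
      using False by (simp add: field_simps power2_eq_square power4_eq_xxxx)
    finally show ?thesis .
  qed simp
  have nonneg: "0 \<le> ?F n x" for n x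
    by (auto intro!: divide_nonneg_nonneg add_nonneg_nonneg mult_nonneg_nonneg sum_nonneg)
  have "summable (\<lambda>n. integral\<^sup>L M (?F n))"
  proof (rule summable_comparison_test')
    show "summable (\<lambda>n. 20 * C * inverse ((real n)\<^sup>2))"
      by (intro summable_mult inverse_power_summable) simp
    show "norm (integral\<^sup>L M (?F n)) \<le> 20 * C * inverse ((real n)\<^sup>2)" for n
    proof -
      have "0 \<le> integral\<^sup>L M (?F n)"
        by (rule integral_nonneg_AE) (use nonneg in auto)
      then show ?thesis using boundF[of n] by simp
    qed
  qed
  with intF nonneg have "AE x in M. (\<lambda>n. ?F n x) \<longlonglongrightarrow> 0"
    by (rule AE_tendsto_zero_if_summable_integral)
  then show ?thesis
  proof eventually_elim
    case (elim x)
    let ?s = "\<lambda>k. (\<Sum>i<k. D i x) / real k"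
    \<comment> \<open>\<open>floor_sqrt k\<close> is the \<open>n\<close> whose interval between
      squares contains \<open>k\<close>; composing turns the limit in \<open>n\<close> into one in
      \<open>k\<close>.\<close>
    have F: "(\<lambda>k. ?F (floor_sqrt k) x) \<longlonglongrightarrow> 0"
      using elim filterlim_floor_sqrt_at_top by (rule filterlim_compose)
    have "(\<lambda>k. (?s k)\<^sup>2) \<longlonglongrightarrow> 0"
    proof (rule tendsto_sandwich[OF _ _ tendsto_const F])
      show "\<forall>\<^sub>F k in sequentially. (?s k)\<^sup>2 \<le> ?F (floor_sqrt k) x"
        using eventually_gt_at_top[of 0]
      proof eventually_elim
        case (elim k)
        let ?n = "floor_sqrt k"
        have "real (?n\<^sup>2) \<le> real k"
          by (simp only: of_nat_le_iff floor_sqrt_power2_le)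
        then have "(real ?n ^ 2)\<^sup>2 \<le> (real k)\<^sup>2"
          by (intro power_mono) auto
        then have "real ?n ^ 4 \<le> (real k)\<^sup>2" "0 < real ?n ^ 4"
          using elim by auto
        then have "(\<Sum>i<k. D i x)\<^sup>2 / (real k)\<^sup>2 \<le> (\<Sum>i<k. D i x)\<^sup>2 / real ?n ^ 4"
          by (intro divide_left_mono) (auto intro: mult_pos_pos)
        also have "\<dots> \<le> ?F ?n x"
          using square_sum_le[of ?n k "\<lambda>i. D i x"] Suc_floor_sqrt_power2_gt[of k]
          by (intro divide_right_mono) auto
        finally show ?case
          by (simp add: power_divide)
      qed
    qed auto
    then show ?case by simp
  qed
qed

section \<open>The age process driven by random erasures\<close>

text \<open>The hypothesis on \<open>W\<close> expresses dependence on the first \<open>n\<close>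
  erasures only. There are finitely many such words, so \<open>W\<close> is bounded and lives on a
  discrete space, where measurability is automatic.\<close>

lemma (in prob_space) integrable_erasure_prefix:
  fixes E :: "nat \<Rightarrow> 'a \<Rightarrow> bool" and W :: "(nat \<Rightarrow> bool) \<Rightarrow> real"
  assumes E: "\<And>i. i \<ge> 1 \<Longrightarrow> E i \<in> measurable M (count_space UNIV)"
    and W: "\<And>e. W (restrict e {1..n}) = W e"
  shows "integrable M (\<lambda>\<omega>. W (\<lambda>i. E i \<omega>))"
proof -
  let ?P = "PiM {1..n} (\<lambda>_. count_space (UNIV :: bool set))"
  have P: "?P = count_space (PiE {1..n} (\<lambda>_. UNIV))"
    by (rule count_space_PiM_finite) auto
  have restr: "W (\<lambda>i. E i \<omega>) = W (\<lambda>i\<in>{1..n}. E i \<omega>)" for \<omega>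
    by (rule W[symmetric])
  have "(\<lambda>\<omega>. \<lambda>i\<in>{1..n}. E i \<omega>) \<in> measurable M ?P"
    using E by (intro measurable_restrict) auto
  moreover have "W \<in> borel_measurable ?P"
    unfolding P by simp
  ultimately have "(\<lambda>\<omega>. W (\<lambda>i\<in>{1..n}. E i \<omega>)) \<in> borel_measurable M"
    by (rule measurable_compose)
  moreover have "finite (W ` PiE {1..n} (\<lambda>_. UNIV))"
    by (intro finite_imageI finite_PiE) auto
  then obtain K where K: "\<And>e. e \<in> PiE {1..n} (\<lambda>_. UNIV) \<Longrightarrow> norm (W e) \<le> K"
    using finite_imp_bounded bounded_iff by (metis imageI)
  ultimately show ?thesis
    unfolding restr by (intro integrable_const_bound[where B=K]) (auto intro!: AE_I2)
qed

text \<open>Erasure \<open>n + 1\<close> is independent of the block of the first \<open>n\<close>,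
  so the expectation factorises. This takes the place of conditioning on the past.\<close>

lemma (in prob_space) expectation_next_erasure:
  fixes E :: "nat \<Rightarrow> 'a \<Rightarrow> bool" and W :: "(nat \<Rightarrow> bool) \<Rightarrow> real"
  assumes E: "erasure_process M \<epsilon> E"
    and W: "\<And>e. W (restrict e {1..n}) = W e"
  shows "expectation (\<lambda>\<omega>. of_bool (E (Suc n) \<omega>) * W (\<lambda>i. E i \<omega>)) =
    \<epsilon> * expectation (\<lambda>\<omega>. W (\<lambda>i. E i \<omega>))"
proof -
  let ?P = "\<lambda>I. PiM I (\<lambda>_. count_space (UNIV :: bool set))"
  have indep: "indep_vars (\<lambda>_. count_space UNIV) E {1..}"
    and prob: "prob {\<omega> \<in> space M. E (Suc n) \<omega>} = \<epsilon>"
    using E by (auto simp: erasure_process_def)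
  have rv: "E i \<in> measurable M (count_space UNIV)" if "i \<ge> 1" for i
    using indep that by (auto simp: indep_vars_def)
  have "indep_var (?P {Suc n}) (\<lambda>\<omega>. \<lambda>i\<in>{Suc n}. E i \<omega>) (?P {1..n}) (\<lambda>\<omega>. \<lambda>i\<in>{1..n}. E i \<omega>)"
    using indep by (rule indep_var_restrict) auto
  moreover have "(\<lambda>e. of_bool (e (Suc n)) :: real) \<in> borel_measurable (?P {Suc n})"
    by (rule measurable_compose[OF measurable_component_singleton]) auto
  moreover have "W \<in> borel_measurable (?P {1..n})"
    by (subst count_space_PiM_finite) auto
  ultimately have "indep_var borel ((\<lambda>e. of_bool (e (Suc n))) \<circ> (\<lambda>\<omega>. \<lambda>i\<in>{Suc n}. E i \<omega>))
      borel (W \<circ> (\<lambda>\<omega>. \<lambda>i\<in>{1..n}. E i \<omega>))"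
    by (rule indep_var_compose)
  moreover have "W (\<lambda>i\<in>{1..n}. E i \<omega>) = W (\<lambda>i. E i \<omega>)" for \<omega>
    by (rule W)
  ultimately have "indep_var borel (\<lambda>\<omega>. of_bool (E (Suc n) \<omega>)) borel (\<lambda>\<omega>. W (\<lambda>i. E i \<omega>))"
    by (simp add: comp_def)
  moreover have "integrable M (\<lambda>\<omega>. W (\<lambda>i. E i \<omega>))"
    using rv W by (rule integrable_erasure_prefix[where E=E and W=W and n=n])
  moreover have "integrable M (\<lambda>\<omega>. of_bool (E (Suc n) \<omega>) :: real)"
    using integrable_erasure_prefix[where E=E and n="Suc n" and W="\<lambda>e. of_bool (e (Suc n))"]
    by (simp add: rv)
  moreover have "expectation (\<lambda>\<omega>. of_bool (E (Suc n) \<omega>)) = \<epsilon>"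
  proof -
    let ?S = "{\<omega> \<in> space M. E (Suc n) \<omega>}"
    have "expectation (\<lambda>\<omega>. of_bool (E (Suc n) \<omega>)) = expectation (indicator ?S)"
      by (intro Bochner_Integration.integral_cong) (auto simp: indicator_def)
    also have "\<dots> = prob (?S \<inter> space M)"
      by simp
    also have "?S \<inter> space M = ?S"
      by blast
    finally show ?thesis
      by (simp only: prob)
  qed
  ultimately show ?thesis
    by (simp add: indep_var_lebesgue_integral)
qed

text \<open>\<open>\<psi> j\<close> is the age just after channel use \<open>j\<close> when that use is not erased; a period \<open>T\<close> separates
  consecutive uses.\<close>

primrec sampled_age :: "real \<Rightarrow> real \<Rightarrow> (nat \<Rightarrow> real) \<Rightarrow> (nat \<Rightarrow> bool) \<Rightarrow> nat \<Rightarrow> real" where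
  "sampled_age x T \<psi> e 0 = x"
| "sampled_age x T \<psi> e (Suc i) = (if e (Suc i) then sampled_age x T \<psi> e i + T else \<psi> (Suc i))"

text \<open>The recursion up to \<open>i\<close> reads only the erasures \<open>1, ..., i\<close>,
  as the lemmas on prefixes demand. \<open>Suc 0\<close> is the form to which the simplifier
  rewrites the bound in \<open>{1..n}\<close>.\<close>

lemma sampled_age_restrict:
  "i \<le> n \<Longrightarrow> sampled_age x T \<psi> (restrict e {Suc 0..n}) i = sampled_age x T \<psi> e i"
  by (induction i) auto

text \<open>The second moments obey \<open>s (n + 1) \<le> r * s n + K\<close> with
  \<open>r < 1\<close>: an erasure, of probability \<epsilon>, carries the square on, and a
  successful use replaces it by a bounded value.\<close>

lemma (in prob_space) sampled_age_second_moment_bounded: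
  fixes E :: "nat \<Rightarrow> 'a \<Rightarrow> bool"
  assumes E: "erasure_process M \<epsilon> E" and \<epsilon>: "0 \<le> \<epsilon>" "\<epsilon> < 1" and B: "\<And>j. \<bar>\<psi> j\<bar> \<le> B"
  shows "\<exists>G. \<forall>n. expectation (\<lambda>\<omega>. (sampled_age x T \<psi> (\<lambda>i. E i \<omega>) n)\<^sup>2) \<le> G"
proof -
  let ?X = "\<lambda>n \<omega>. sampled_age x T \<psi> (\<lambda>i. E i \<omega>) n"
  have rv: "E i \<in> measurable M (count_space UNIV)" if "i \<ge> 1" for i
    using E that by (auto simp: erasure_process_def indep_vars_def)
  \<comment> \<open>\<open>r = \<epsilon> * (1 + (1 - \<epsilon>))\<close> arises from Young's
    inequality for \<open>(a + T)^2\<close> with weight \<open>1 - \<epsilon>\<close>; it equals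
    \<open>1 - (1 - \<epsilon>)^2\<close>.\<close>
  define r where "r = \<epsilon> * (2 - \<epsilon>)"
  define K where "K = B\<^sup>2 + (1 + 1 / (1 - \<epsilon>)) * T\<^sup>2"
  have r: "r < 1"
  proof -
    have "1 - r = (1 - \<epsilon>)\<^sup>2" by (simp add: r_def power2_eq_square algebra_simps)
    also have "\<dots> > 0" using \<epsilon> by simp
    finally show ?thesis by simp
  qed
  have K: "K \<ge> 0"
    using \<epsilon> by (simp add: K_def)
  have step: "expectation (\<lambda>\<omega>. (?X (Suc n) \<omega>)\<^sup>2) \<le> r * expectation (\<lambda>\<omega>. (?X n \<omega>)\<^sup>2) + K" for n
  proof -
    let ?W = "\<lambda>e. (sampled_age x T \<psi> e n + T)\<^sup>2 - (\<psi> (Suc n))\<^sup>2"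
    have int: "integrable M (\<lambda>\<omega>. (?X n \<omega> + T)\<^sup>2)" "integrable M (\<lambda>\<omega>. (?X n \<omega>)\<^sup>2)"
      "integrable M (\<lambda>\<omega>. of_bool (E (Suc n) \<omega>) * ?W (\<lambda>i. E i \<omega>))"
      using
        integrable_erasure_prefix[where E=E and n=n and W="\<lambda>e. (sampled_age x T \<psi> e n + T)\<^sup>2"]
        integrable_erasure_prefix[where E=E and n=n and W="\<lambda>e. (sampled_age x T \<psi> e n)\<^sup>2"]
        integrable_erasure_prefix[where E=E and n="Suc n" and W="\<lambda>e. of_bool (e (Suc n)) * ?W e"]
      by (simp_all add: rv sampled_age_restrict)
    have next_erasure: "expectation (\<lambda>\<omega>. of_bool (E (Suc n) \<omega>) * ?W (\<lambda>i. E i \<omega>)) =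
        \<epsilon> * expectation (\<lambda>\<omega>. ?W (\<lambda>i. E i \<omega>))"
      using E by (rule expectation_next_erasure[where W="?W" and n=n]) (simp add: sampled_age_restrict)
    \<comment> \<open>Both cases of the recursion in one formula: the value without erasure plus the
      indicator times the difference.\<close>
    have "expectation (\<lambda>\<omega>. (?X (Suc n) \<omega>)\<^sup>2) =
        expectation (\<lambda>\<omega>. (\<psi> (Suc n))\<^sup>2 + of_bool (E (Suc n) \<omega>) * ((?X n \<omega> + T)\<^sup>2 - (\<psi> (Suc n))\<^sup>2))"
      by (intro Bochner_Integration.integral_cong) auto
    also have "\<dots> = (\<psi> (Suc n))\<^sup>2 + \<epsilon> * expectation (\<lambda>\<omega>. (?X n \<omega> + T)\<^sup>2 - (\<psi> (Suc n))\<^sup>2)"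
      using int(3) by (simp add: prob_space next_erasure)
    also have "\<dots> = (1 - \<epsilon>) * (\<psi> (Suc n))\<^sup>2 + \<epsilon> * expectation (\<lambda>\<omega>. (?X n \<omega> + T)\<^sup>2)"
      using int(1) by (simp add: prob_space algebra_simps)
    also have "\<dots> \<le> B\<^sup>2 + \<epsilon> * ((2 - \<epsilon>) * expectation (\<lambda>\<omega>. (?X n \<omega>)\<^sup>2) + (1 + 1 / (1 - \<epsilon>)) * T\<^sup>2)"
    proof (intro add_mono mult_left_mono \<epsilon>)
      have "(\<psi> (Suc n))\<^sup>2 \<le> B\<^sup>2"
        using B[of "Suc n"] by (simp add: abs_le_square_iff[symmetric])
      then show "(1 - \<epsilon>) * (\<psi> (Suc n))\<^sup>2 \<le> B\<^sup>2"
        using \<epsilon> mult_left_le_one_le[of "(\<psi> (Suc n))\<^sup>2" "1 - \<epsilon>"] by simp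
      have young: "(a + T)\<^sup>2 \<le> (2 - \<epsilon>) * a\<^sup>2 + (1 + 1 / (1 - \<epsilon>)) * T\<^sup>2" for a
      proof -
        have "0 \<le> ((1 - \<epsilon>) * a - T)\<^sup>2 / (1 - \<epsilon>)"
          using \<epsilon> by simp
        also have "\<dots> = (2 - \<epsilon>) * a\<^sup>2 + (1 + 1 / (1 - \<epsilon>)) * T\<^sup>2 - (a + T)\<^sup>2"
          using \<epsilon> by (simp add: field_simps power2_eq_square)
        finally show ?thesis by simp
      qed
      have "expectation (\<lambda>\<omega>. (?X n \<omega> + T)\<^sup>2) \<le>
          expectation (\<lambda>\<omega>. (2 - \<epsilon>) * (?X n \<omega>)\<^sup>2 + (1 + 1 / (1 - \<epsilon>)) * T\<^sup>2)"
        using int by (intro integral_mono young) auto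
      also have "\<dots> = (2 - \<epsilon>) * expectation (\<lambda>\<omega>. (?X n \<omega>)\<^sup>2) + (1 + 1 / (1 - \<epsilon>)) * T\<^sup>2"
        using int by (simp add: prob_space)
      finally show "expectation (\<lambda>\<omega>. (?X n \<omega> + T)\<^sup>2) \<le> \<dots>" .
    qed
    also have "\<dots> = r * expectation (\<lambda>\<omega>. (?X n \<omega>)\<^sup>2) + B\<^sup>2 + \<epsilon> * ((1 + 1 / (1 - \<epsilon>)) * T\<^sup>2)"
      by (simp add: r_def algebra_simps)
    also have "\<epsilon> * ((1 + 1 / (1 - \<epsilon>)) * T\<^sup>2) \<le> (1 + 1 / (1 - \<epsilon>)) * T\<^sup>2"
      using \<epsilon> by (intro mult_left_le_one_le) auto
    finally show ?thesis by (simp add: K_def)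
  qed
  \<comment> \<open>\<open>K / (1 - r)\<close> is the fixed point of
    \<open>s \<mapsto> r * s + K\<close>; \<open>x^2\<close> accounts for the start.\<close>
  have "expectation (\<lambda>\<omega>. (?X n \<omega>)\<^sup>2) \<le> x\<^sup>2 + K / (1 - r)" for n
  proof (induction n)
    case 0
    then show ?case using r K by (simp add: prob_space)
  next
    case (Suc n)
    have r0: "0 \<le> r" using \<epsilon> by (simp add: r_def)
    have "expectation (\<lambda>\<omega>. (?X (Suc n) \<omega>)\<^sup>2) \<le> r * (x\<^sup>2 + K / (1 - r)) + K"
      using step[of n] mult_left_mono[OF Suc r0] by linarith
    also have "\<dots> = r * x\<^sup>2 + K / (1 - r)"
      using r by (simp add: field_simps)
    also have "r * x\<^sup>2 \<le> x\<^sup>2"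
      using r r0 by (intro mult_left_le_one_le) auto
    finally show ?case by simp
  qed
  then show ?thesis by (intro exI allI)
qed

text \<open>With \<open>D n\<close> the martingale difference below,
  \<open>X (n + 1) = \<epsilon> X n + \<epsilon> T + (1 - \<epsilon>) \<psi> (n + 1) + D n\<close>. Averaging over \<open>n\<close> gives the mean of \<open>X\<close>,
  as the means of \<open>D\<close> and the boundary term \<open>X n / n\<close> vanish in the limit.\<close>

lemma (in prob_space) sampled_age_mean:
  fixes E :: "nat \<Rightarrow> 'a \<Rightarrow> bool"
  assumes E: "erasure_process M \<epsilon> E" and \<epsilon>: "0 \<le> \<epsilon>" "\<epsilon> < 1" and B: "\<And>j. \<bar>\<psi> j\<bar> \<le> B"
    and \<kappa>: "(\<lambda>n. (\<Sum>j<n. \<psi> (Suc j)) / real n) \<longlonglongrightarrow> \<kappa>"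
  shows "AE \<omega> in M. (\<lambda>n. (\<Sum>i<n. sampled_age x T \<psi> (\<lambda>i. E i \<omega>) i) / real n)
    \<longlonglongrightarrow> \<epsilon> * T / (1 - \<epsilon>) + \<kappa>"
proof -
  let ?X = "\<lambda>e n. sampled_age x T \<psi> e n"
  \<comment> \<open>\<open>?V\<close> is the change of the next value that an erasure causes;
    \<open>?D\<close> is this change with the indicator centred.\<close>
  let ?V = "\<lambda>e n. ?X e n + (T - \<psi> (Suc n))"
  let ?D = "\<lambda>n \<omega>. (of_bool (E (Suc n) \<omega>) - \<epsilon>) * ?V (\<lambda>i. E i \<omega>) n"
  have rv: "E i \<in> measurable M (count_space UNIV)" if "i \<ge> 1" for i
    using E that by (auto simp: erasure_process_def indep_vars_def)
  obtain G where G: "\<forall>n. expectation (\<lambda>\<omega>. (?X (\<lambda>i. E i \<omega>) n)\<^sup>2) \<le> G"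
    using sampled_age_second_moment_bounded[where x=x and T=T and \<psi>=\<psi>, OF E \<epsilon> B]
    by (elim exE) (simp only: simp_thms)
  have intX2: "integrable M (\<lambda>\<omega>. (?X (\<lambda>i. E i \<omega>) n)\<^sup>2)" for n
    using integrable_erasure_prefix[where E=E and n=n and W="\<lambda>e. (?X e n)\<^sup>2"]
    by (simp add: rv sampled_age_restrict)
  have "AE \<omega> in M. (\<lambda>n. (\<Sum>i<n. ?D i \<omega>) / real n) \<longlonglongrightarrow> 0"
  proof (rule slln_orthogonal)
    show int: "integrable M (\<lambda>\<omega>. ?D i \<omega> * ?D j \<omega>)" for i j
      using integrable_erasure_prefix[where E=E and n="Suc (max i j)" and
          W="\<lambda>e. ((of_bool (e (Suc i)) - \<epsilon>) * ?V e i) * ((of_bool (e (Suc j)) - \<epsilon>) * ?V e j)"]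
      by (simp add: rv sampled_age_restrict)
    show "expectation (\<lambda>\<omega>. ?D i \<omega> * ?D j \<omega>) = 0" if "i < j" for i j
    proof -
      \<comment> \<open>Everything in the product except erasure \<open>Suc j\<close> is fixed by
        the first \<open>j\<close> erasures, as \<open>Suc i \<le> j\<close>; the centred indicator
        then averages to zero.\<close>
      let ?W = "\<lambda>e. (of_bool (e (Suc i)) - \<epsilon>) * ?V e i * ?V e j"
      have W: "?W (restrict e {1..j}) = ?W e" for e
        using \<open>i < j\<close> by (simp add: sampled_age_restrict)
      have int: "integrable M (\<lambda>\<omega>. of_bool (E (Suc j) \<omega>) * ?W (\<lambda>i. E i \<omega>))"
        using \<open>i < j\<close>
          integrable_erasure_prefix[where E=E and n="Suc j" and W="\<lambda>e. of_bool (e (Suc j)) * ?W e"]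
        by (simp add: rv sampled_age_restrict)
      have intW: "integrable M (\<lambda>\<omega>. ?W (\<lambda>i. E i \<omega>))"
        using rv W by (rule integrable_erasure_prefix[where E=E and n=j and W="?W"])
      have "expectation (\<lambda>\<omega>. ?D i \<omega> * ?D j \<omega>) =
          expectation (\<lambda>\<omega>. of_bool (E (Suc j) \<omega>) * ?W (\<lambda>i. E i \<omega>) - \<epsilon> * ?W (\<lambda>i. E i \<omega>))"
        by (intro Bochner_Integration.integral_cong) (auto simp: algebra_simps)
      also have "\<dots> = 0"
        using int intW expectation_next_erasure[where W="?W" and n=j, OF E W]
        by (subst Bochner_Integration.integral_diff) (auto intro: integrable_mult_right)
      finally show ?thesis .
    qed
    show "expectation (\<lambda>\<omega>. (?D i \<omega>)\<^sup>2) \<le> 2 * G + 2 * (\<bar>T\<bar> + B)\<^sup>2" for i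
    proof -
      have "(?D i \<omega>)\<^sup>2 \<le> 2 * (?X (\<lambda>i. E i \<omega>) i)\<^sup>2 + 2 * (\<bar>T\<bar> + B)\<^sup>2" for \<omega>
      proof -
        let ?v = "T - \<psi> (Suc i)"
        have "(of_bool (E (Suc i) \<omega>) - \<epsilon>)\<^sup>2 \<le> 1"
          using \<epsilon> by (subst abs_square_le_1) (auto simp: of_bool_def)
        then have "(?D i \<omega>)\<^sup>2 \<le> (?V (\<lambda>i. E i \<omega>) i)\<^sup>2"
          unfolding power_mult_distrib by (rule mult_left_le_one_le[rotated 2]) auto
        also have "\<dots> \<le> 2 * (?X (\<lambda>i. E i \<omega>) i)\<^sup>2 + 2 * ?v\<^sup>2"
          using sum_squares_bound[of "?X (\<lambda>i. E i \<omega>) i" ?v] by (simp add: power2_sum)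
        also have "\<bar>?v\<bar> \<le> \<bar>T\<bar> + B"
          using B[of "Suc i"] by linarith
        then have "?v\<^sup>2 \<le> (\<bar>T\<bar> + B)\<^sup>2"
          by (metis abs_ge_zero power2_abs power_mono)
        finally show ?thesis by simp
      qed
      then have "expectation (\<lambda>\<omega>. (?D i \<omega>)\<^sup>2) \<le>
          expectation (\<lambda>\<omega>. 2 * (?X (\<lambda>i. E i \<omega>) i)\<^sup>2 + 2 * (\<bar>T\<bar> + B)\<^sup>2)"
        using int[of i i] intX2 by (intro integral_mono) (auto simp: power2_eq_square)
      also have "\<dots> = 2 * expectation (\<lambda>\<omega>. (?X (\<lambda>i. E i \<omega>) i)\<^sup>2) + 2 * (\<bar>T\<bar> + B)\<^sup>2"
        using intX2 by (simp add: prob_space)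
      finally show ?thesis using G[rule_format, of i] by simp
    qed
  qed
  \<comment> \<open>By the bounded second moments the expectation of \<open>(X n / n)^2\<close> is
    at most \<open>G / n^2\<close>, which is summable.\<close>
  moreover have "AE \<omega> in M. (\<lambda>n. (?X (\<lambda>i. E i \<omega>) n / real n)\<^sup>2) \<longlonglongrightarrow> 0"
  proof (rule AE_tendsto_zero_if_summable_integral)
    show "integrable M (\<lambda>\<omega>. (?X (\<lambda>i. E i \<omega>) n / real n)\<^sup>2)" for n
      using intX2[of n] by (simp add: power_divide)
    show "summable (\<lambda>n. expectation (\<lambda>\<omega>. (?X (\<lambda>i. E i \<omega>) n / real n)\<^sup>2))"
    proof (rule summable_comparison_test')
      show "summable (\<lambda>n. G * inverse ((real n)\<^sup>2))"
        by (intro summable_mult inverse_power_summable) simp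
      show "norm (expectation (\<lambda>\<omega>. (?X (\<lambda>i. E i \<omega>) n / real n)\<^sup>2)) \<le> G * inverse ((real n)\<^sup>2)" for n
        using divide_right_mono[OF G[rule_format, of n], of "(real n)\<^sup>2"]
        unfolding power_divide integral_divide_zero by (simp add: divide_inverse)
    qed
  qed simp
  ultimately show ?thesis
  proof eventually_elim
    case (elim \<omega>)
    let ?x = "?X (\<lambda>i. E i \<omega>)"
    have bd: "(\<lambda>n. ?x n / real n) \<longlonglongrightarrow> 0"
      using elim(2) by simp
    have rec: "?x (Suc i) = \<epsilon> * ?x i + \<epsilon> * T + (1 - \<epsilon>) * \<psi> (Suc i) + ?D i \<omega>" for i
      by (auto simp: algebra_simps)
    \<comment> \<open>Summing the recursion gives the sum of \<open>X 1, ..., X n\<close> on the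
      left; exchanging it for that of \<open>X 0, ..., X (n - 1)\<close> leaves
      \<open>x - X n\<close>.\<close>
    have sum: "(1 - \<epsilon>) * (\<Sum>i<n. ?x i) =
        real n * (\<epsilon> * T) + (1 - \<epsilon>) * (\<Sum>j<n. \<psi> (Suc j)) + (\<Sum>i<n. ?D i \<omega>) + x - ?x n" for n
    proof (induction n)
      case (Suc n)
      show ?case
        unfolding sum.lessThan_Suc distrib_left Suc rec[of n] by (simp add: algebra_simps)
    qed simp
    have "(\<lambda>n. (\<epsilon> * T + (1 - \<epsilon>) * ((\<Sum>j<n. \<psi> (Suc j)) / real n) + (\<Sum>i<n. ?D i \<omega>) / real n
        + x / real n - ?x n / real n) / (1 - \<epsilon>)) \<longlonglongrightarrow> (\<epsilon> * T + (1 - \<epsilon>) * \<kappa> + 0 + 0 - 0) / (1 - \<epsilon>)"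
      using \<epsilon> by (intro tendsto_intros \<kappa> elim(1) bd lim_const_over_n) auto
    also have "(\<epsilon> * T + (1 - \<epsilon>) * \<kappa> + 0 + 0 - 0) / (1 - \<epsilon>) = \<epsilon> * T / (1 - \<epsilon>) + \<kappa>"
      using \<epsilon> by (simp add: field_simps)
    finally show ?case
    proof (rule Lim_transform_eventually)
      show "\<forall>\<^sub>F n in sequentially. (\<epsilon> * T + (1 - \<epsilon>) * ((\<Sum>j<n. \<psi> (Suc j)) / real n)
          + (\<Sum>i<n. ?D i \<omega>) / real n + x / real n - ?x n / real n) / (1 - \<epsilon>) = (\<Sum>i<n. ?x i) / real n"
        using eventually_gt_at_top[of 0]
      proof eventually_elim
        case (elim n)
        have "\<epsilon> * T + (1 - \<epsilon>) * ((\<Sum>j<n. \<psi> (Suc j)) / real n)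
            + (\<Sum>i<n. ?D i \<omega>) / real n + x / real n - ?x n / real n =
            (real n * (\<epsilon> * T) + (1 - \<epsilon>) * (\<Sum>j<n. \<psi> (Suc j)) + (\<Sum>i<n. ?D i \<omega>) + x - ?x n) / real n"
          using elim by (simp add: add_divide_distrib diff_divide_distrib)
        also have "\<dots> = (1 - \<epsilon>) * (\<Sum>i<n. ?x i) / real n"
          by (simp only: sum)
        finally show ?case
          using \<epsilon> by simp
      qed
    qed
  qed
qed

section \<open>Time averages of piecewise linear age functions\<close>

text \<open>\<open>X n\<close> is a difference of consecutive partial sums, so
  \<open>X n / n\<close> is a difference of two sequences that both tend to
  \<open>L\<close>.\<close>

lemma term_over_n_tendsto_zero:
  fixes X :: "nat \<Rightarrow> real"
  assumes "(\<lambda>n. (\<Sum>i<n. X i) / real n) \<longlonglongrightarrow> L"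
  shows "(\<lambda>n. X n / real n) \<longlonglongrightarrow> 0"
proof -
  let ?m = "\<lambda>n. (\<Sum>i<n. X i) / real n"
  have "(\<lambda>n. ?m (Suc n) * (1 + 1 / real n) - ?m n) \<longlonglongrightarrow> L * (1 + 0) - L"
    using LIMSEQ_Suc[OF assms] assms by (intro tendsto_intros lim_1_over_n)
  then have "(\<lambda>n. ?m (Suc n) * (1 + 1 / real n) - ?m n) \<longlonglongrightarrow> 0"
    by simp
  then show ?thesis
  proof (rule Lim_transform_eventually)
    show "\<forall>\<^sub>F n in sequentially. ?m (Suc n) * (1 + 1 / real n) - ?m n = X n / real n"
      using eventually_gt_at_top[of 0]
    proof eventually_elim
      case (elim n)
      then have "1 + 1 / real n = real (Suc n) / real n"
        by (simp add: field_simps)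
      then have "?m (Suc n) * (1 + 1 / real n) = (\<Sum>i<Suc n. X i) / real n"
        by simp
      then show ?case
        by (simp add: add_divide_distrib)
    qed
  qed
qed

text \<open>An age profile of slope one: during the \<open>i\<close>-th period of length
  \<open>T\<close>, age is measured from the time stamp \<open>c i\<close>.\<close>

definition sawtooth :: "real \<Rightarrow> (nat \<Rightarrow> real) \<Rightarrow> real \<Rightarrow> real" where
  "sawtooth T c t = t - c (nat \<lfloor>t / T\<rfloor>)"

lemma sawtooth_has_integral_piece:
  assumes T: "T > 0" and \<tau>: "real n * T \<le> \<tau>" "\<tau> \<le> real (Suc n) * T"
  shows "(sawtooth T c has_integral
    (\<tau> - real n * T) * (real n * T - c n) + (\<tau> - real n * T)\<^sup>2 / 2) {real n * T..\<tau>}"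
proof -
  have "((\<lambda>t. t - c n) has_integral
      (\<tau>\<^sup>2 - (real n * T)\<^sup>2) / 2 - (\<tau> - real n * T) *\<^sub>R c n) {real n * T..\<tau>}"
    using \<tau>(1) has_integral_const_real[of "c n" "real n * T" \<tau>]
    by (intro has_integral_diff ident_has_integral) simp_all
  also have "(\<tau>\<^sup>2 - (real n * T)\<^sup>2) / 2 - (\<tau> - real n * T) *\<^sub>R c n =
      (\<tau> - real n * T) * (real n * T - c n) + (\<tau> - real n * T)\<^sup>2 / 2"
    by (simp add: power2_eq_square algebra_simps) (simp add: field_simps)
  finally show ?thesis
  \<comment> \<open>If \<open>\<tau> = (n + 1) * T\<close>, the floor has already jumped at the
    right end point, so that point is left out.\<close>
  proof (rule has_integral_spike_finite[rotated 2])
    fix t assume t: "t \<in> {real n * T..\<tau>} - {\<tau>}"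
    with \<tau> have "real n * T \<le> t" "t < real (Suc n) * T" by auto
    with T have "\<lfloor>t / T\<rfloor> = int n"
      by (intro floor_unique) (auto simp: field_simps)
    then show "sawtooth T c t = t - c n"
      by (simp add: sawtooth_def)
  qed simp
qed

lemma sawtooth_has_integral_multiple:
  assumes T: "T > 0"
  shows "(sawtooth T c has_integral T * (\<Sum>i<n. real i * T - c i) + real n * T\<^sup>2 / 2) {0..real n * T}"
proof (induction n)
  case (Suc n)
  have "(sawtooth T c has_integral T * (real n * T - c n) + T\<^sup>2 / 2) {real n * T..real (Suc n) * T}"
    using sawtooth_has_integral_piece[OF T, of n "real (Suc n) * T" c] T by (simp add: algebra_simps)
  with Suc have "(sawtooth T c has_integral T * (\<Sum>i<n. real i * T - c i) + real n * T\<^sup>2 / 2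
      + (T * (real n * T - c n) + T\<^sup>2 / 2)) {0..real (Suc n) * T}"
    by (rule has_integral_combine[rotated 2]) (use T in auto)
  then show ?case by (simp add: algebra_simps add_divide_distrib)
qed (simp add: has_integral_refl)

lemma sawtooth_has_integral:
  assumes T: "T > 0" and "\<tau> \<ge> 0"
  defines "n \<equiv> nat \<lfloor>\<tau> / T\<rfloor>"
  shows "(sawtooth T c has_integral T * (\<Sum>i<n. real i * T - c i) + real n * T\<^sup>2 / 2
    + ((\<tau> - real n * T) * (real n * T - c n) + (\<tau> - real n * T)\<^sup>2 / 2)) {0..\<tau>}"
proof -
  have "real n = of_int \<lfloor>\<tau> / T\<rfloor>"
    using assms by (simp add: n_def)
  then have "real n \<le> \<tau> / T" "\<tau> / T \<le> real (Suc n)"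
    by linarith+
  then have "real n * T \<le> \<tau>" "\<tau> \<le> real (Suc n) * T"
    using T by (simp_all add: field_simps)
  then show ?thesis
    using T by (intro has_integral_combine[OF _ _ sawtooth_has_integral_multiple
        sawtooth_has_integral_piece]) auto
qed

lemma sawtooth_integrable: "T > 0 \<Longrightarrow> \<tau> \<ge> 0 \<Longrightarrow> sawtooth T c integrable_on {0..\<tau>}"
  using sawtooth_has_integral by blast

text \<open>Each full period contributes \<open>T\<close> times its initial age and a triangle
  \<open>T^2 / 2\<close>, whence \<open>L + T / 2\<close>. The incomplete last period has length at
  most \<open>T\<close> and an initial age that is \<open>o(n)\<close>.\<close>

lemma sawtooth_mean:
  assumes T: "T > 0" and L: "(\<lambda>n. (\<Sum>i<n. real i * T - c i) / real n) \<longlonglongrightarrow> L"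
  shows "((\<lambda>\<tau>. 1 / \<tau> * integral {0..\<tau>} (sawtooth T c)) \<longlongrightarrow> L + T / 2) at_top"
proof -
  define n where "n = (\<lambda>\<tau>. nat \<lfloor>\<tau> / T\<rfloor>)"
  let ?m = "\<lambda>n. (\<Sum>i<n. real i * T - c i) / real n"
  let ?\<delta> = "\<lambda>\<tau>. \<tau> - real (n \<tau>) * T"
  let ?u = "\<lambda>\<tau>. real (n \<tau>) * T / \<tau>"
  let ?x = "\<lambda>\<tau>. (real (n \<tau>) * T - c (n \<tau>)) / real (n \<tau>)"
  have \<delta>: "0 \<le> ?\<delta> \<tau>" "?\<delta> \<tau> \<le> T" if "\<tau> \<ge> 0" for \<tau>
  proof -
    have "real (n \<tau>) = of_int \<lfloor>\<tau> / T\<rfloor>"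
      using that T by (simp add: n_def)
    then have "real (n \<tau>) \<le> \<tau> / T" "\<tau> / T \<le> real (n \<tau>) + 1"
      by linarith+
    then show "0 \<le> ?\<delta> \<tau>" "?\<delta> \<tau> \<le> T"
      using T by (simp_all add: field_simps)
  qed
  have n: "filterlim n at_top at_top"
    unfolding n_def filterlim_at_top
  proof
    fix Z :: nat
    show "\<forall>\<^sub>F \<tau> in at_top. Z \<le> nat \<lfloor>\<tau> / T\<rfloor>"
      using eventually_ge_at_top[of "real Z * T"]
    proof eventually_elim
      case (elim \<tau>)
      then have "real Z \<le> \<tau> / T" using T by (simp add: field_simps)
      then show ?case by linarith
    qed
  qed
  have over: "((\<lambda>\<tau>. T / \<tau>) \<longlongrightarrow> 0) at_top" "((\<lambda>\<tau>. T\<^sup>2 / \<tau>) \<longlongrightarrow> 0) at_top"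
    by (rule tendsto_divide_0[OF tendsto_const filterlim_at_top_imp_at_infinity[OF filterlim_ident]])+
  have small: "((\<lambda>\<tau>. ?\<delta> \<tau> / \<tau>) \<longlongrightarrow> 0) at_top" "((\<lambda>\<tau>. (?\<delta> \<tau>)\<^sup>2 / \<tau>) \<longlongrightarrow> 0) at_top"
  proof -
    have ev: "\<forall>\<^sub>F \<tau> in at_top. norm (?\<delta> \<tau> / \<tau>) \<le> T / \<tau>" "\<forall>\<^sub>F \<tau> in at_top. norm ((?\<delta> \<tau>)\<^sup>2 / \<tau>) \<le> T\<^sup>2 / \<tau>"
      using eventually_gt_at_top[of 0] eventually_gt_at_top[of 0]
      by (eventually_elim, use \<delta> in \<open>auto intro!: divide_right_mono power_mono\<close>)+
    show "((\<lambda>\<tau>. ?\<delta> \<tau> / \<tau>) \<longlongrightarrow> 0) at_top"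
      by (rule Lim_null_comparison[OF ev(1) over(1)])
    show "((\<lambda>\<tau>. (?\<delta> \<tau>)\<^sup>2 / \<tau>) \<longlongrightarrow> 0) at_top"
      by (rule Lim_null_comparison[OF ev(2) over(2)])
  qed
  have u: "(?u \<longlongrightarrow> 1) at_top"
  proof (rule Lim_transform_eventually)
    show "((\<lambda>\<tau>. 1 - ?\<delta> \<tau> / \<tau>) \<longlongrightarrow> 1) at_top"
      using tendsto_diff[OF tendsto_const small(1), of 1] by simp
    show "\<forall>\<^sub>F \<tau> in at_top. 1 - ?\<delta> \<tau> / \<tau> = ?u \<tau>"
      using eventually_gt_at_top[of 0] by eventually_elim (simp add: field_simps)
  qed
  have x: "(?x \<longlongrightarrow> 0) at_top"
    using term_over_n_tendsto_zero[OF L] n by (rule filterlim_compose)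
  have m: "((\<lambda>\<tau>. ?m (n \<tau>)) \<longlongrightarrow> L) at_top"
    using L n by (rule filterlim_compose)
  \<comment> \<open>The summands are the initial ages of the full periods, their triangles, then the
    rectangle and the triangle of the incomplete last period.\<close>
  have "((\<lambda>\<tau>. ?u \<tau> * ?m (n \<tau>) + ?u \<tau> * T / 2 + (?\<delta> \<tau> / \<tau> * (real (n \<tau>) * ?x \<tau>)) + (?\<delta> \<tau>)\<^sup>2 / \<tau> / 2)
      \<longlongrightarrow> 1 * L + 1 * T / 2 + 0 + 0 / 2) at_top"
  proof (intro tendsto_add tendsto_mult tendsto_divide tendsto_const u m small(2))
    show "((\<lambda>\<tau>. ?\<delta> \<tau> / \<tau> * (real (n \<tau>) * ?x \<tau>)) \<longlongrightarrow> 0) at_top"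
    proof (rule Lim_null_comparison)
      show "((\<lambda>\<tau>. ?u \<tau> * \<bar>?x \<tau>\<bar>) \<longlongrightarrow> 0) at_top"
        using tendsto_mult[OF u tendsto_rabs[OF x]] by simp
      show "\<forall>\<^sub>F \<tau> in at_top. norm (?\<delta> \<tau> / \<tau> * (real (n \<tau>) * ?x \<tau>)) \<le> ?u \<tau> * \<bar>?x \<tau>\<bar>"
        using eventually_gt_at_top[of 0]
      proof eventually_elim
        case (elim \<tau>)
        have "norm (?\<delta> \<tau> / \<tau> * (real (n \<tau>) * ?x \<tau>)) = ?\<delta> \<tau> / \<tau> * (real (n \<tau>) * \<bar>?x \<tau>\<bar>)"
          unfolding real_norm_def abs_mult using \<delta>[of \<tau>] elim by simp
        also have "\<dots> \<le> T / \<tau> * (real (n \<tau>) * \<bar>?x \<tau>\<bar>)"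
          using \<delta>[of \<tau>] elim by (intro mult_right_mono divide_right_mono) auto
        finally show ?case by (simp only: divide_inverse mult_ac)
      qed
    qed
  qed simp_all
  then have "((\<lambda>\<tau>. ?u \<tau> * ?m (n \<tau>) + ?u \<tau> * T / 2 + (?\<delta> \<tau> / \<tau> * (real (n \<tau>) * ?x \<tau>)) + (?\<delta> \<tau>)\<^sup>2 / \<tau> / 2)
      \<longlongrightarrow> L + T / 2) at_top"
    by simp
  then show ?thesis
  proof (rule Lim_transform_eventually)
    show "\<forall>\<^sub>F \<tau> in at_top. ?u \<tau> * ?m (n \<tau>) + ?u \<tau> * T / 2 + (?\<delta> \<tau> / \<tau> * (real (n \<tau>) * ?x \<tau>))
        + (?\<delta> \<tau>)\<^sup>2 / \<tau> / 2 = 1 / \<tau> * integral {0..\<tau>} (sawtooth T c)"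
      \<comment> \<open>From \<open>T\<close> on at least one full period is over, which makes the
        division by \<open>n \<tau>\<close> legitimate.\<close>
      using eventually_ge_at_top[of T]
    proof eventually_elim
      case (elim \<tau>)
      then have "\<tau> > 0" using T by simp
      moreover have "real (n \<tau>) > 0"
      proof -
        have "1 \<le> \<tau> / T" using elim T by simp
        then have "0 < n \<tau>" unfolding n_def by linarith
        then show ?thesis by simp
      qed
      moreover have "integral {0..\<tau>} (sawtooth T c) =
          T * (\<Sum>i<n \<tau>. real i * T - c i) + real (n \<tau>) * T\<^sup>2 / 2
          + (?\<delta> \<tau> * (real (n \<tau>) * T - c (n \<tau>)) + (?\<delta> \<tau>)\<^sup>2 / 2)"
        using sawtooth_has_integral[OF T, of \<tau> c] \<open>\<tau> > 0\<close>
        by (intro integral_unique) (simp add: n_def)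
      ultimately show ?case
        by (simp add: add_divide_distrib power2_eq_square)
    qed
  qed
qed

lemma sawtooth_mean_mono:
  assumes T: "T > 0" and le: "\<And>i. c i \<le> c' i"
    and a: "((\<lambda>\<tau>. 1 / \<tau> * integral {0..\<tau>} (sawtooth T c)) \<longlongrightarrow> a) at_top"
    and a': "((\<lambda>\<tau>. 1 / \<tau> * integral {0..\<tau>} (sawtooth T c')) \<longlongrightarrow> a') at_top"
  shows "a' \<le> a"
proof (rule tendsto_le[OF _ a a'])
  show "\<forall>\<^sub>F \<tau> in at_top. 1 / \<tau> * integral {0..\<tau>} (sawtooth T c') \<le> 1 / \<tau> * integral {0..\<tau>} (sawtooth T c)"
    using eventually_gt_at_top[of 0]
  proof eventually_elim
    case (elim \<tau>)
    then show ?case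
      using T le by (intro mult_left_mono integral_le sawtooth_integrable) (auto simp: sawtooth_def)
  qed
qed simp

section \<open>Coding schemes\<close>

lemma nth_map_upt_1: "1 \<le> k \<Longrightarrow> k \<le> n \<Longrightarrow> map F [1..<Suc n] ! (k - 1) = F k"
  by (subst nth_map_upt) auto

text \<open>\<open>e i\<close> means that use \<open>i\<close> is erased. The start value
  \<open>0\<close> agrees with the index that stands for ERASURE.\<close>

primrec freshest :: "(nat \<Rightarrow> nat) \<Rightarrow> (nat \<Rightarrow> bool) \<Rightarrow> nat \<Rightarrow> nat" where
  "freshest M e 0 = 0"
| "freshest M e (Suc i) = (if e (Suc i) then freshest M e i else M (Suc i))"

text \<open>For the converse: no unerased input up to use \<open>i\<close> can depend on a message
  beyond \<open>freshest M e i\<close>.\<close>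

lemma le_freshest:
  assumes "mono M"
  shows "1 \<le> j \<Longrightarrow> j \<le> i \<Longrightarrow> \<not> e j \<Longrightarrow> M j \<le> freshest M e i"
proof (induction i)
  case (Suc i)
  show ?case
  proof (cases "e (Suc i)")
    case True
    with Suc.prems have "j \<noteq> Suc i" by auto
    with Suc True show ?thesis by simp
  next
    case False
    then show ?thesis using monoD[OF assms \<open>j \<le> Suc i\<close>] by simp
  qed
qed simp

section \<open>Achievability: the newest symbol sent uncoded\<close>

definition newest_symbol_encoder :: "nat \<Rightarrow> nat list \<Rightarrow> nat" where
  "newest_symbol_encoder i us = (if us = [] then 0 else last us)"

text \<open>The search runs backwards to the last unerased output; \<open>zs ! i\<close> is the
  output of use \<open>Suc i\<close>. The message index is read off from \<open>M\<close>, which the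
  receiver knows. A filler received while no message exists yields \<open>None\<close>.\<close>

primrec newest_symbol_decoder :: "(nat \<Rightarrow> nat) \<Rightarrow> nat \<Rightarrow> nat option list \<Rightarrow> (nat \<times> nat) option" where
  "newest_symbol_decoder M 0 zs = None"
| "newest_symbol_decoder M (Suc i) zs = (case zs ! i of
      None \<Rightarrow> newest_symbol_decoder M i zs
    | Some v \<Rightarrow> if M (Suc i) = 0 then None else Some (v, M (Suc i)))"

lemma newest_symbol_decoder_range:
  assumes "mono M" "set zs \<subseteq> insert None (Some ` {..<q})"
  shows "i \<le> length zs \<Longrightarrow>
    newest_symbol_decoder M i zs \<in> insert None (Some ` ({..<q} \<times> {1..M i}))"
proof (induction i)
  case (Suc i)
  have "zs ! i \<in> insert None (Some ` {..<q})"
    using Suc.prems assms(2) nth_mem[of i zs] by (intro subsetD[OF assms(2)]) simp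
  moreover have "M i \<le> M (Suc i)"
    using assms(1) by (simp add: monoD)
  then have "insert None (Some ` ({..<q} \<times> {1..M i})) \<subseteq> insert None (Some ` ({..<q} \<times> {1..M (Suc i)}))"
    by auto
  ultimately show ?case
    using Suc by (auto split: option.splits)
qed simp

lemma coding_scheme_newest_symbol:
  assumes "mono M" "q > 0"
  shows "coding_scheme {..<q} q M newest_symbol_encoder (newest_symbol_decoder M)"
  unfolding coding_scheme_def
proof (intro allI impI conjI)
  fix i us assume "length us = M i \<and> set us \<subseteq> {..<q}"
  then show "newest_symbol_encoder i us \<in> {..<q}"
    using assms(2) subsetD[of "set us" "{..<q}" "last us"] by (simp add: newest_symbol_encoder_def)
next
  fix i zs assume "length zs = i \<and> set zs \<subseteq> insert None (Some ` {..<q})"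
  then show "newest_symbol_decoder M i zs \<in> insert None (Some ` ({..<q} \<times> {1..M i}))"
    using newest_symbol_decoder_range[OF assms(1), of zs q i] by simp
qed

lemma decoder_output_newest_symbol:
  "decoder_output M newest_symbol_encoder (newest_symbol_decoder M) U E i \<omega> =
    (let m = freshest M (\<lambda>i. E i \<omega>) i in if m = 0 then None else Some (U m \<omega>, m))"
proof -
  define zs where "zs = map (\<lambda>j. channel_output M newest_symbol_encoder U E j \<omega>) [1..<Suc i]"
  have "newest_symbol_decoder M k zs =
      (let m = freshest M (\<lambda>i. E i \<omega>) k in if m = 0 then None else Some (U m \<omega>, m))" if "k \<le> i" for k
    using that
  proof (induction k)
    case (Suc k)
    then have "zs ! k = channel_output M newest_symbol_encoder U E (Suc k) \<omega>"
      using nth_map_upt_1[of "Suc k" i] by (simp add: zs_def del: upt_Suc)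
    with Suc show ?case
      by (auto simp: channel_output_def channel_input_def newest_symbol_encoder_def Let_def)
  qed simp
  then show ?thesis
    by (simp add: decoder_output_def zs_def)
qed

lemma decoded_index_newest_symbol:
  "decoded_index M newest_symbol_encoder (newest_symbol_decoder M) U E i \<omega> = freshest M (\<lambda>i. E i \<omega>) i"
  by (simp add: decoded_index_def decoder_output_newest_symbol Let_def)

lemma never_errs_newest_symbol:
  "never_errs Pr M newest_symbol_encoder (newest_symbol_decoder M) U E"
  by (auto simp: never_errs_def decoder_output_newest_symbol Let_def)

section \<open>Converse: finite prefixes and an altered source symbol\<close>

text \<open>The event constrains finitely many coordinates, so it is a finite intersection of
  one-coordinate cylinders, even if \<open>I\<close> is infinite.\<close>

lemma sets_PiM_map_eq:
  fixes I :: "'i set" and l :: "'b list"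
  assumes "set xs \<subseteq> I"
  shows "{g \<in> space (PiM I (\<lambda>_. count_space UNIV)). map g xs = l} \<in> sets (PiM I (\<lambda>_. count_space UNIV))"
  using assms
proof (induction xs arbitrary: l)
  case Nil
  then show ?case by (cases l) auto
next
  case (Cons x xs)
  let ?P = "PiM I (\<lambda>_. count_space (UNIV :: 'b set))"
  show ?case
  proof (cases l)
    case (Cons a l')
    have "(\<lambda>g. g x) \<in> measurable ?P (count_space UNIV)"
      using Cons.prems by (intro measurable_component_singleton) auto
    then have "(\<lambda>g. g x) -` {a} \<inter> space ?P \<in> sets ?P"
      by (rule measurable_sets) simp
    moreover have "{g \<in> space ?P. map g xs = l'} \<in> sets ?P"
      using Cons.prems by (intro Cons.IH) auto
    ultimately have "((\<lambda>g. g x) -` {a} \<inter> space ?P) \<inter> {g \<in> space ?P. map g xs = l'} \<in> sets ?P"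
      by (rule sets.Int)
    also have "((\<lambda>g. g x) -` {a} \<inter> space ?P) \<inter> {g \<in> space ?P. map g xs = l'} =
        {g \<in> space ?P. map g (x # xs) = l}"
      using Cons by auto
    finally show ?thesis .
  qed auto
qed

lemma prefix_event_in_vimage_algebra:
  "{\<omega> \<in> \<Omega>. map (\<lambda>j. X j \<omega>) [1..<Suc n] = l} \<in>
    sets (vimage_algebra \<Omega> (\<lambda>\<omega>. \<lambda>i\<in>{1..}. X i \<omega>) (PiM {1..} (\<lambda>_. count_space UNIV)))"
proof -
  let ?P = "PiM {1..} (\<lambda>_. count_space UNIV)"
  have "(\<lambda>\<omega>. \<lambda>i\<in>{1..}. X i \<omega>) -` {g \<in> space ?P. map g [1..<Suc n] = l} \<inter> \<Omega> \<in>
      sets (vimage_algebra \<Omega> (\<lambda>\<omega>. \<lambda>i\<in>{1..}. X i \<omega>) ?P)"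
    by (intro in_vimage_algebra sets_PiM_map_eq) auto
  also have "(\<lambda>\<omega>. \<lambda>i\<in>{1..}. X i \<omega>) -` {g \<in> space ?P. map g [1..<Suc n] = l} \<inter> \<Omega> =
      {\<omega> \<in> \<Omega>. map (\<lambda>j. X j \<omega>) [1..<Suc n] = l}"
  proof -
    have "map (\<lambda>i\<in>{1..}. X i \<omega>) [1..<Suc n] = map (\<lambda>j. X j \<omega>) [1..<Suc n]" for \<omega>
      by (intro map_cong) auto
    then show ?thesis
      by (auto simp: space_PiM simp del: upt_Suc)
  qed
  finally show ?thesis .
qed

context prob_space
begin

lemma prob_prefixes:
  assumes "independent_processes M U E"
  shows "prob {\<omega> \<in> space M. map (\<lambda>m. U m \<omega>) [1..<Suc n] = u \<and> map (\<lambda>j. E j \<omega>) [1..<Suc i] = e} =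
      prob {\<omega> \<in> space M. map (\<lambda>m. U m \<omega>) [1..<Suc n] = u} *
      prob {\<omega> \<in> space M. map (\<lambda>j. E j \<omega>) [1..<Suc i] = e}"
    and "{\<omega> \<in> space M. map (\<lambda>m. U m \<omega>) [1..<Suc n] = u \<and> map (\<lambda>j. E j \<omega>) [1..<Suc i] = e} \<in> events"
proof -
  let ?A = "{\<omega> \<in> space M. map (\<lambda>m. U m \<omega>) [1..<Suc n] = u}"
  let ?B = "{\<omega> \<in> space M. map (\<lambda>j. E j \<omega>) [1..<Suc i] = e}"
  have AB: "{\<omega> \<in> space M. map (\<lambda>m. U m \<omega>) [1..<Suc n] = u \<and> map (\<lambda>j. E j \<omega>) [1..<Suc i] = e} = ?A \<inter> ?B"
    by blast
  note indep = assms[unfolded independent_processes_def]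
  show "prob {\<omega> \<in> space M. map (\<lambda>m. U m \<omega>) [1..<Suc n] = u \<and> map (\<lambda>j. E j \<omega>) [1..<Suc i] = e} =
      prob ?A * prob ?B"
    unfolding AB using indep by (rule indep_setD) (rule prefix_event_in_vimage_algebra)+
  have "?A \<in> events"
    using indep_setD_ev1[OF indep] prefix_event_in_vimage_algebra by (rule subsetD)
  moreover have "?B \<in> events"
    using indep_setD_ev2[OF indep] prefix_event_in_vimage_algebra by (rule subsetD)
  ultimately show "{\<omega> \<in> space M. map (\<lambda>m. U m \<omega>) [1..<Suc n] = u \<and>
      map (\<lambda>j. E j \<omega>) [1..<Suc i] = e} \<in> events"
    unfolding AB by (rule sets.Int)
qed

lemma prob_source_prefix_pos:
  assumes "memoryless_source M p U" "length u = n" "set u \<subseteq> set_pmf p"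
  shows "0 < prob {\<omega> \<in> space M. map (\<lambda>m. U m \<omega>) [1..<Suc n] = u}"
\<comment> \<open>The empty prefix is separate because an empty intersection is the whole type and
  not \<open>space M\<close>.\<close>
proof (cases "n = 0")
  case True
  then show ?thesis using assms(2) by (simp add: prob_space)
next
  case False
  have indep: "indep_vars (\<lambda>_. count_space UNIV) U {1..}"
    and distr: "\<And>m. m \<ge> 1 \<Longrightarrow> distr M (count_space UNIV) (U m) = measure_pmf p"
    using assms(1) by (auto simp: memoryless_source_def)
  have "{\<omega> \<in> space M. map (\<lambda>m. U m \<omega>) [1..<Suc n] = u} =
      (\<Inter>m\<in>{1..n}. U m -` {u ! (m - 1)} \<inter> space M)"
  proof -
    have "map (\<lambda>m. U m \<omega>) [1..<Suc n] = u \<longleftrightarrow> (\<forall>m\<in>{1..n}. U m \<omega> = u ! (m - 1))" for \<omega>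
    proof -
      have "map (\<lambda>m. U m \<omega>) [1..<Suc n] = u \<longleftrightarrow> (\<forall>k<n. U (Suc k) \<omega> = u ! k)"
        using assms(2) by (auto simp: list_eq_iff_nth_eq simp del: upt_Suc)
      also have "\<dots> \<longleftrightarrow> (\<forall>m\<in>{1..n}. U m \<omega> = u ! (m - 1))"
        by (metis One_nat_def Suc_le_eq Suc_pred' atLeastAtMost_iff diff_Suc_1 le_add1 plus_1_eq_Suc)
      finally show ?thesis .
    qed
    then show ?thesis using False by auto
  qed
  then have "prob {\<omega> \<in> space M. map (\<lambda>m. U m \<omega>) [1..<Suc n] = u} =
      (\<Prod>m\<in>{1..n}. prob (U m -` {u ! (m - 1)} \<inter> space M))"
    using indep_varsD[OF indep, of "{1..n}" "\<lambda>m. {u ! (m - 1)}"] False by auto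
  also have "\<dots> = (\<Prod>m\<in>{1..n}. pmf p (u ! (m - 1)))"
  proof (rule prod.cong[OF refl])
    fix m assume m: "m \<in> {1..n}"
    then have "U m \<in> measurable M (count_space UNIV)"
      using indep by (auto simp: indep_vars_def)
    then have "measure (distr M (count_space UNIV) (U m)) {u ! (m - 1)} = prob (U m -` {u ! (m - 1)} \<inter> space M)"
      by (rule measure_distr) simp
    then show "prob (U m -` {u ! (m - 1)} \<inter> space M) = pmf p (u ! (m - 1))"
      using distr[of m] m by (simp add: pmf.rep_eq)
  qed
  also have "\<dots> > 0"
  proof (rule prod_pos)
    fix m assume "m \<in> {1..n}"
    then have "u ! (m - 1) \<in> set u"
      using assms(2) by (intro nth_mem) auto
    then show "0 < pmf p (u ! (m - 1))"
      using assms(3) by (auto simp: pmf_positive)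
  qed
  finally show ?thesis .
qed

lemma AE_source_in_set_pmf:
  assumes "memoryless_source M p U"
  shows "AE \<omega> in M. \<forall>m\<ge>1. U m \<omega> \<in> set_pmf p"
proof -
  have "AE \<omega> in M. U m \<omega> \<in> set_pmf p" if "m \<ge> 1" for m
  proof -
    have distr: "distr M (count_space UNIV) (U m) = measure_pmf p"
      using assms that by (simp add: memoryless_source_def)
    have "U m \<in> measurable M (count_space UNIV)"
      using assms that by (auto simp: memoryless_source_def indep_vars_def)
    moreover have "AE u in distr M (count_space UNIV) (U m). u \<in> set_pmf p"
      unfolding distr by (rule AE_measure_pmf)
    ultimately show ?thesis
      by (rule AE_distrD[where P="\<lambda>u. u \<in> set_pmf p"])
  qed
  then show ?thesis by (simp add: AE_all_countable)
qed

lemma AE_ex_in_event: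
  assumes "AE \<omega> in M. P \<omega>" "A \<in> events" "0 < prob A"
  shows "\<exists>\<omega>\<in>A. P \<omega>"
proof (rule ccontr)
  assume "\<not> ?thesis"
  with assms(1) have "AE \<omega> in M. \<omega> \<notin> A"
    by (auto elim: eventually_mono)
  with assms(2,3) show False
    by (simp add: prob_eq_0[symmetric])
qed

text \<open>If a message newer than those known to the encoder at the last unerased channel use were
  decoded, then changing only its symbol would leave all channel outputs, hence the decoder output,
  as they are. The changed source prefix has positive probability, so the decoder would err.\<close>

lemma AE_decoded_index_le_freshest:
  fixes U :: "nat \<Rightarrow> 'a \<Rightarrow> nat"
  assumes source: "memoryless_source M p U" and p: "set_pmf p = {..<q}" and q: "q \<ge> 2"
    and indep: "independent_processes M U E"
    and K: "mono K"
    and scheme: "coding_scheme {..<q} q K f g" and errs: "never_errs M K f g U E"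
  shows "AE \<omega> in M. \<forall>i. decoded_index K f g U E i \<omega> \<le> freshest K (\<lambda>i. E i \<omega>) i"
proof -
  let ?u = "\<lambda>n \<omega>. map (\<lambda>m. U m \<omega>) [1..<Suc n]"
  let ?e = "\<lambda>i \<omega>. map (\<lambda>j. E j \<omega>) [1..<Suc i]"
  let ?correct = "\<lambda>\<omega>. \<forall>i\<ge>1. \<forall>u m. decoder_output K f g U E i \<omega> = Some (u, m) \<longrightarrow> u = U m \<omega>"
  have correct: "AE \<omega> in M. ?correct \<omega>"
    using errs by (simp add: never_errs_def AE_all_countable)
  \<comment> \<open>Finite erasure words are countable, so almost surely none of the observed ones
    is null.\<close>
  have pos: "AE \<omega> in M. \<forall>i. \<forall>e. ?e i \<omega> = e \<longrightarrow> prob {\<omega> \<in> space M. ?e i \<omega> = e} > 0"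
    unfolding AE_all_countable
  proof (intro allI)
    fix i e
    let ?B = "{\<omega> \<in> space M. ?e i \<omega> = e}"
    show "AE \<omega> in M. ?e i \<omega> = e \<longrightarrow> prob ?B > 0"
    proof (cases "prob ?B = 0")
      case True
      have "?B \<in> events"
        using indep_setD_ev2[OF indep[unfolded independent_processes_def]] prefix_event_in_vimage_algebra
        by (rule subsetD)
      with True have "AE \<omega> in M. \<omega> \<notin> ?B"
        by (simp only: prob_eq_0)
      then show ?thesis
        using AE_space by eventually_elim auto
    next
      case False
      then have "prob ?B > 0"
        using measure_nonneg[of M ?B] by linarith
      then show ?thesis by simp
    qed
  qed
  show ?thesis
    using AE_source_in_set_pmf[OF source] correct pos
  proof eventually_elim
    case (elim \<omega>)
    note U = elim(1) and corr = elim(2)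
    show ?case
    proof (intro allI, rule ccontr)
      fix i assume *: "\<not> decoded_index K f g U E i \<omega> \<le> freshest K (\<lambda>i. E i \<omega>) i"
      define m where "m = decoded_index K f g U E i \<omega>"
      have i: "i \<ge> 1"
        using * by (cases i) (auto simp: decoded_index_def)
      from * obtain v where out: "decoder_output K f g U E i \<omega> = Some (v, m)"
        by (auto simp: decoded_index_def m_def split: option.splits if_splits)
      have v: "v = U m \<omega>"
        using corr i out by blast
      have "channel_output K f U E j \<omega> \<in> insert None (Some ` {..<q})" if "j \<ge> 1" for j
      proof -
        have "length (?u (K j) \<omega>) = K j \<and> set (?u (K j) \<omega>) \<subseteq> {..<q}"
          using U p by auto
        then have "f j (?u (K j) \<omega>) \<in> {..<q}"
          using scheme that unfolding coding_scheme_def by blast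
        then show ?thesis
          by (auto simp: channel_output_def channel_input_def)
      qed
      then have "length (map (\<lambda>j. channel_output K f U E j \<omega>) [1..<Suc i]) = i \<and>
          set (map (\<lambda>j. channel_output K f U E j \<omega>) [1..<Suc i]) \<subseteq> insert None (Some ` {..<q})"
        by auto
      then have "decoder_output K f g U E i \<omega> \<in> insert None (Some ` ({..<q} \<times> {1..K i}))"
        using scheme i unfolding coding_scheme_def decoder_output_def by blast
      with out have m: "1 \<le> m" "m \<le> K i"
        by auto
      \<comment> \<open>\<open>q \<ge> 2\<close> enters here: a second letter exists to replace the
        decoded symbol.\<close>
      obtain b where b: "b < q" "b \<noteq> U m \<omega>"
      proof (cases "U m \<omega> = 0")
        case True
        with q show thesis by (intro that[of 1]) auto
      next
        case False
        with q show thesis by (intro that[of 0]) auto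
      qed
      define u' where "u' = (?u (K i) \<omega>)[m - 1 := b]"
      have "set u' \<subseteq> insert b (set (?u (K i) \<omega>))"
        unfolding u'_def by (rule set_update_subset_insert)
      also have "\<dots> \<subseteq> set_pmf p"
        using U b(1) p by auto
      finally have u': "set u' \<subseteq> set_pmf p" .
      have len: "length u' = K i"
        by (simp add: u'_def)
      \<comment> \<open>Same erasures, source prefix altered at \<open>m\<close>. By independence
        the event is not null, so it contains a point at which the decoder is correct.\<close>
      let ?B = "{\<omega>' \<in> space M. ?u (K i) \<omega>' = u' \<and> ?e i \<omega>' = ?e i \<omega>}"
      have "prob ?B > 0"
        unfolding prob_prefixes(1)[OF indep]
        using prob_source_prefix_pos[OF source len u'] elim(3) by (intro mult_pos_pos) auto
      then obtain \<omega>' where \<omega>': "\<omega>' \<in> ?B" "?correct \<omega>'"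
        using AE_ex_in_event[OF correct prob_prefixes(2)[OF indep]] by blast
      have Usame: "U k \<omega>' = (if k = m then b else U k \<omega>)" if "1 \<le> k" "k \<le> K i" for k
      proof -
        have "U k \<omega>' = ?u (K i) \<omega>' ! (k - 1)"
          using that nth_map_upt_1[of k "K i" "\<lambda>k. U k \<omega>'"] by simp
        also have "?u (K i) \<omega>' = u'"
          using \<omega>'(1) by blast
        also have "u' ! (k - 1) = (if k = m then b else U k \<omega>)"
          using that m nth_map_upt_1[of k "K i" "\<lambda>k. U k \<omega>"]
          unfolding u'_def by (auto simp: nth_list_update simp del: upt_Suc)
        finally show ?thesis .
      qed
      have Esame: "E j \<omega>' = E j \<omega>" if "1 \<le> j" "j \<le> i" for j
      proof -
        have "?e i \<omega>' = ?e i \<omega>"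
          using \<omega>'(1) by blast
        then have "?e i \<omega>' ! (j - 1) = ?e i \<omega> ! (j - 1)"
          by (rule arg_cong)
        then show ?thesis
          unfolding nth_map_upt_1[OF that] .
      qed
      have "channel_output K f U E j \<omega>' = channel_output K f U E j \<omega>" if j: "1 \<le> j" "j \<le> i" for j
      proof (cases "E j \<omega>")
        case False
        \<comment> \<open>The encoder of an unerased use \<open>j\<close> has seen only
          \<open>K j < m\<close> messages, so the altered symbol cannot show in its input.\<close>
        have "K j \<le> freshest K (\<lambda>i. E i \<omega>) i"
          using le_freshest[OF K j, of "\<lambda>i. E i \<omega>"] False by blast
        then have "K j < m"
          using * by (simp add: m_def)
        moreover have "K j \<le> K i"
          using K j by (simp add: monoD)
        ultimately have "?u (K j) \<omega>' = ?u (K j) \<omega>"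
          using Usame by (intro map_cong) auto
        then show ?thesis
          using Esame[OF j] by (simp only: channel_output_def channel_input_def)
      qed (use Esame[OF j] in \<open>simp add: channel_output_def\<close>)
      then have "map (\<lambda>j. channel_output K f U E j \<omega>') [1..<Suc i] =
          map (\<lambda>j. channel_output K f U E j \<omega>) [1..<Suc i]"
        by (intro map_cong) auto
      then have "decoder_output K f g U E i \<omega>' = Some (v, m)"
        using out by (simp only: decoder_output_def)
      then have "v = U m \<omega>'"
        using \<omega>'(2) i by blast
      then show False
        using v b(2) Usame[OF m] by simp
    qed
  qed
qed

end

section \<open>The optimal average age\<close>

text \<open>The finitely many differing terms amount to a constant \<open>?c\<close>, which vanishes
  after division by \<open>n\<close>. This disposes of channel uses before the source
  starts.\<close>

lemma mean_tendsto_cong: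
  fixes f g :: "nat \<Rightarrow> real"
  assumes ev: "\<forall>\<^sub>F n in sequentially. f n = g n" and f: "(\<lambda>n. (\<Sum>i<n. f i) / real n) \<longlonglongrightarrow> L"
  shows "(\<lambda>n. (\<Sum>i<n. g i) / real n) \<longlonglongrightarrow> L"
proof -
  obtain N where N: "\<And>n. n \<ge> N \<Longrightarrow> f n = g n"
    using ev by (auto simp: eventually_sequentially)
  let ?c = "(\<Sum>i<N. g i) - (\<Sum>i<N. f i)"
  have "(\<lambda>n. (\<Sum>i<n. f i) / real n + ?c / real n) \<longlonglongrightarrow> L + 0"
    by (intro tendsto_add f lim_const_over_n)
  then have "(\<lambda>n. (\<Sum>i<n. f i) / real n + ?c / real n) \<longlonglongrightarrow> L"
    by simp
  then show ?thesis
  proof (rule Lim_transform_eventually)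
    show "\<forall>\<^sub>F n in sequentially. (\<Sum>i<n. f i) / real n + ?c / real n = (\<Sum>i<n. g i) / real n"
      using eventually_ge_at_top[of N]
    proof eventually_elim
      case (elim n)
      have "(\<Sum>i<n. h i) = (\<Sum>i<N. h i) + (\<Sum>i=N..<n. h i)" for h :: "nat \<Rightarrow> real"
        using elim by (simp add: lessThan_atLeast0 sum.atLeastLessThan_concat)
      moreover have "(\<Sum>i=N..<n. f i) = (\<Sum>i=N..<n. g i)"
        using N by (intro sum.cong) auto
      ultimately have "(\<Sum>i<n. g i) = (\<Sum>i<n. f i) + ?c"
        by simp
      then show ?case
        by (simp add: add_divide_distrib)
    qed
  qed
qed

section \<open>Residual age at unerased channel uses\<close>

lemma mono_num_messages:
  assumes "lam > 0" "mu > 0"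
  shows "mono (num_messages lam mu t0)"
proof (rule monoI)
  fix i j :: nat assume "i \<le> j"
  then have "real i * (1 / mu) \<le> real j * (1 / mu)"
    using assms(2) by (intro mult_right_mono) auto
  then have "(real i * (1 / mu) - t0) / (1 / lam) \<le> (real j * (1 / mu) - t0) / (1 / lam)"
    using assms(1) by (intro divide_right_mono) auto
  then show "num_messages lam mu t0 i \<le> num_messages lam mu t0 j"
    unfolding num_messages_def by (intro nat_mono floor_mono)
qed

text \<open>Age right after use \<open>j\<close> if the newest available message is known. It is
  negative for uses before \<open>t0\<close>, where the message count is clamped at
  \<open>0\<close>.\<close>

definition residual_age :: "real \<Rightarrow> real \<Rightarrow> real \<Rightarrow> nat \<Rightarrow> real" where
  "residual_age lam mu t0 j = real j * (1 / mu) - t0 - real (num_messages lam mu t0 j) * (1 / lam)"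

lemma residual_age_nonneg_time:
  assumes "lam > 0" "0 \<le> real j * (1 / mu) - t0"
  shows "residual_age lam mu t0 j = frac (lam * (real j * (1 / mu) - t0)) / lam"
proof -
  have "0 \<le> lam * (real j * (1 / mu) - t0)"
    using assms by (intro mult_nonneg_nonneg) auto
  then have "real (num_messages lam mu t0 j) = of_int \<lfloor>lam * (real j * (1 / mu) - t0)\<rfloor>"
    by (simp add: num_messages_def mult.commute)
  then show ?thesis
    using assms(1) by (simp add: residual_age_def frac_def diff_divide_distrib)
qed

lemma residual_age_negative_time:
  assumes "lam > 0" "real j * (1 / mu) - t0 < 0"
  shows "residual_age lam mu t0 j = real j * (1 / mu) - t0"
proof -
  have "(real j * (1 / mu) - t0) / (1 / lam) < 0"
    using assms by (intro divide_neg_pos) auto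
  then show ?thesis
    by (simp add: residual_age_def num_messages_def)
qed

text \<open>From \<open>t0\<close> on the residual age is a fraction of the source period
  \<open>1 / lam\<close>; before \<open>t0\<close> it lies between \<open>- t0\<close> and
  \<open>0\<close>, whence the summand \<open>\<bar>t0\<bar>\<close>.\<close>

lemma abs_residual_age_le:
  assumes "lam > 0" "mu > 0"
  shows "\<bar>residual_age lam mu t0 j\<bar> \<le> 1 / lam + \<bar>t0\<bar>"
proof (cases "0 \<le> real j * (1 / mu) - t0")
  case True
  have "\<bar>frac (lam * (real j * (1 / mu) - t0)) / lam\<bar> \<le> 1 / lam"
    using assms(1) frac_lt_1[of "lam * (real j * (1 / mu) - t0)"]
    by (simp add: divide_right_mono)
  then show ?thesis
    using residual_age_nonneg_time[OF assms(1) True] by simp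
next
  case False
  have "0 \<le> real j * (1 / mu)" "0 < 1 / lam"
    using assms by auto
  then show ?thesis
    using residual_age_negative_time[OF assms(1), of j mu t0] False by linarith
qed

text \<open>Uses start at index \<open>1\<close>, so the progression in \<open>Suc j\<close> has
  offset \<open>lam / mu - lam * t0\<close>. The closed form holds from \<open>t0\<close> on, which
  excludes finitely many terms.\<close>

lemma residual_age_mean:
  assumes lam: "lam > 0" and mu: "mu > 0"
    and \<kappa>: "(\<lambda>n. (\<Sum>j<n. frac ((lam / mu - lam * t0) + real j * (lam / mu))) / real n) \<longlonglongrightarrow> \<kappa>"
  shows "(\<lambda>n. (\<Sum>j<n. residual_age lam mu t0 (Suc j)) / real n) \<longlonglongrightarrow> \<kappa> / lam"
proof (rule mean_tendsto_cong)
  let ?f = "\<lambda>j. frac ((lam / mu - lam * t0) + real j * (lam / mu)) / lam"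
  show "(\<lambda>n. (\<Sum>j<n. ?f j) / real n) \<longlonglongrightarrow> \<kappa> / lam"
    using tendsto_divide[OF \<kappa> tendsto_const, of lam] lam
    by (simp add: sum_divide_distrib[symmetric] mult.commute)
  obtain N :: nat where N: "mu * t0 < real N"
    using reals_Archimedean2 by blast
  show "\<forall>\<^sub>F j in sequentially. ?f j = residual_age lam mu t0 (Suc j)"
    using eventually_ge_at_top[of N]
  proof eventually_elim
    case (elim j)
    then have "mu * t0 \<le> real (Suc j)"
      using N by linarith
    then have "0 \<le> real (Suc j) * (1 / mu) - t0"
      using mu by (simp add: field_simps)
    then have "residual_age lam mu t0 (Suc j) = frac (lam * (real (Suc j) * (1 / mu) - t0)) / lam"
      using lam by (intro residual_age_nonneg_time)
    also have "lam * (real (Suc j) * (1 / mu) - t0) = (lam / mu - lam * t0) + real j * (lam / mu)"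
      by (simp add: algebra_simps add_divide_distrib)
    finally show ?case by simp
  qed
qed

text \<open>Identifies the scalar recursion with the age along \<open>freshest\<close>. The start
  value \<open>- t0\<close> is the age at time \<open>0\<close> relative to a fictitious message
  \<open>0\<close> at time \<open>t0\<close>.\<close>

lemma sampled_age_residual_age:
  "sampled_age (- t0) (1 / mu) (residual_age lam mu t0) e i =
    real i * (1 / mu) - (real (freshest (num_messages lam mu t0) e i) * (1 / lam) + t0)"
  by (induction i) (simp_all add: residual_age_def add_divide_distrib)

lemma instantaneous_age_eq_sawtooth:
  "instantaneous_age lam mu t0 f g U E \<omega> = sawtooth (1 / mu)
    (\<lambda>i. real (decoded_index (num_messages lam mu t0) f g U E i \<omega>) * (1 / lam) + t0)"
  by (auto simp: instantaneous_age_def sawtooth_def)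

text \<open>Both inequalities refer to the time stamps \<open>?c\<close>: the uncoded scheme
  realises them, and any other scheme almost surely has an age at least as large at all times. The
  constant is the mean time \<open>\<epsilon> / (mu * (1 - \<epsilon>))\<close> since the last
  success plus half a channel period \<open>1 / (2 * mu)\<close>.\<close>

lemma (in prob_space) optimal_average_age_eq:
  fixes U :: "nat \<Rightarrow> 'a \<Rightarrow> nat"
  assumes \<epsilon>: "0 \<le> \<epsilon>" "\<epsilon> < 1" and lam: "lam > 0" and mu: "mu > 0" and q: "q \<ge> 2"
    and source: "memoryless_source M p U" and p: "set_pmf p = {..<q}"
    and E: "erasure_process M \<epsilon> E" and indep: "independent_processes M U E"
    and \<kappa>: "(\<lambda>n. (\<Sum>j<n. frac ((lam / mu - lam * t0) + real j * (lam / mu))) / real n) \<longlonglongrightarrow> \<kappa>"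
  shows "optimal_average_age M {..<q} q lam mu t0 U E =
    ereal (\<kappa> / lam + (1 + \<epsilon>) / (2 * mu * (1 - \<epsilon>)))"
proof -
  let ?K = "num_messages lam mu t0"
  let ?a = "\<kappa> / lam + (1 + \<epsilon>) / (2 * mu * (1 - \<epsilon>))"
  let ?c = "\<lambda>\<omega> i. real (freshest ?K (\<lambda>i. E i \<omega>) i) * (1 / lam) + t0"
  let ?avg = "\<lambda>F. ((\<lambda>\<tau>. 1 / \<tau> * integral {0..\<tau>} F) :: real \<Rightarrow> real)"
  have K: "mono ?K"
    using lam mu by (rule mono_num_messages)
  have "AE \<omega> in M. (\<lambda>n. (\<Sum>i<n. sampled_age (- t0) (1 / mu) (residual_age lam mu t0) (\<lambda>i. E i \<omega>) i) / real n)
      \<longlonglongrightarrow> \<epsilon> * (1 / mu) / (1 - \<epsilon>) + \<kappa> / lam"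
    using lam mu \<kappa> by (intro sampled_age_mean[OF E \<epsilon> abs_residual_age_le] residual_age_mean)
  then have fresh: "AE \<omega> in M. (?avg (sawtooth (1 / mu) (?c \<omega>)) \<longlongrightarrow> ?a) at_top"
  proof eventually_elim
    case (elim \<omega>)
    then have "(?avg (sawtooth (1 / mu) (?c \<omega>)) \<longlongrightarrow>
        \<epsilon> * (1 / mu) / (1 - \<epsilon>) + \<kappa> / lam + (1 / mu) / 2) at_top"
      unfolding sampled_age_residual_age using mu by (intro sawtooth_mean) auto
    also have "\<epsilon> * (1 / mu) / (1 - \<epsilon>) + \<kappa> / lam + (1 / mu) / 2 = ?a"
      using mu lam \<epsilon> by (simp add: divide_simps) (simp add: algebra_simps)
    finally show ?case .
  qed
  show ?thesis
    unfolding optimal_average_age_def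
  proof (rule antisym)
    have "has_average_age M lam mu t0 newest_symbol_encoder (newest_symbol_decoder ?K) U E ?a"
      using fresh
      by (simp add: has_average_age_def instantaneous_age_eq_sawtooth decoded_index_newest_symbol)
    moreover have "coding_scheme {..<q} q ?K newest_symbol_encoder (newest_symbol_decoder ?K)"
      using K q by (intro coding_scheme_newest_symbol) auto
    moreover have "never_errs M ?K newest_symbol_encoder (newest_symbol_decoder ?K) U E"
      by (rule never_errs_newest_symbol)
    ultimately show "Inf {ereal a | a f g. coding_scheme {..<q} q ?K f g \<and>
        never_errs M ?K f g U E \<and> has_average_age M lam mu t0 f g U E a} \<le> ereal ?a"
      by (intro Inf_lower) blast
    show "ereal ?a \<le> Inf {ereal a | a f g. coding_scheme {..<q} q ?K f g \<and>
        never_errs M ?K f g U E \<and> has_average_age M lam mu t0 f g U E a}"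
    proof (rule Inf_greatest, safe)
      fix a f g
      assume scheme: "coding_scheme {..<q} q ?K f g" "never_errs M ?K f g U E"
        and avg: "has_average_age M lam mu t0 f g U E a"
      \<comment> \<open>The inequality does not involve \<open>\<omega>\<close>, so on a probability
        space it holds outright once it holds almost surely.\<close>
      have "AE \<omega> in M. ?a \<le> a"
        using fresh AE_decoded_index_le_freshest[OF source p q indep K scheme]
          avg[unfolded has_average_age_def instantaneous_age_eq_sawtooth]
      proof eventually_elim
        case (elim \<omega>)
        have "real (decoded_index ?K f g U E i \<omega>) * (1 / lam) + t0 \<le> ?c \<omega> i" for i
          using elim(2) lam by (intro add_right_mono mult_right_mono) auto
        moreover have "0 < 1 / mu"
          using mu by simp
        ultimately show "?a \<le> a"
          by (intro sawtooth_mean_mono[OF _ _ elim(3,1)])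
      qed
      then show "ereal ?a \<le> ereal a"
        by simp
    qed
  qed
qed

theorem theorem2:
  fixes Pr :: "'w measure"
    and q :: nat
    and p :: "nat pmf"
    and U :: "nat \<Rightarrow> 'w \<Rightarrow> nat"
    and E :: "nat \<Rightarrow> 'w \<Rightarrow> bool"
    and \<epsilon> lam mu t0 \<rho> :: real
  assumes "prob_space Pr"
    and "0 \<le> \<epsilon>" and "\<epsilon> < 1" and "lam > 0" and "mu > 0"
    and "q \<ge> 2"
    and "memoryless_source Pr p U" and "set_pmf p = {..<q}"
    and "erasure_process Pr \<epsilon> E"
    and "independent_processes Pr U E"
    and "\<rho> = lam / mu"
  shows "(\<rho> \<notin> \<rat> \<longrightarrow>
            optimal_average_age Pr {..<q} q lam mu t0 U E =
              ereal (1 / (2 * lam) + (1 + \<epsilon>) / (2 * mu * (1 - \<epsilon>)))) \<and>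
         (\<forall>c d :: nat. c > 0 \<and> d > 0 \<and> coprime c d \<and> \<rho> = real c / real d \<longrightarrow>
            optimal_average_age Pr {..<q} q lam mu t0 U E =
              ereal (1 / (2 * lam)
                     + (2 * frac (- (real d * lam * t0)) - 1) / (2 * real d * lam)
                     + (1 + \<epsilon>) / (2 * mu * (1 - \<epsilon>))))"
proof (intro conjI impI allI)
  note opt = prob_space.optimal_average_age_eq[OF assms(1-10), folded assms(11)]
  {
    assume "\<rho> \<notin> \<rat>"
    then show "optimal_average_age Pr {..<q} q lam mu t0 U E =
        ereal (1 / (2 * lam) + (1 + \<epsilon>) / (2 * mu * (1 - \<epsilon>)))"
      using opt[OF frac_mean_irrational] by simp
  }
  fix c d :: nat
  assume cd: "c > 0 \<and> d > 0 \<and> coprime c d \<and> \<rho> = real c / real d"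
  let ?r = "frac (- (real d * lam * t0))"
  \<comment> \<open>Multiplying the offset by \<open>d\<close> turns \<open>\<rho>\<close> into the
    integer \<open>c\<close>, which the fractional part drops.\<close>
  have "real d * (\<rho> - lam * t0) = - (real d * lam * t0) + of_int (int c)"
    using cd by (simp add: field_simps)
  then have "frac (real d * (\<rho> - lam * t0)) = ?r"
    by (simp only: frac_add_of_int_right)
  then have "(\<lambda>n. (\<Sum>j<n. frac ((\<rho> - lam * t0) + real j * \<rho>)) / real n)
      \<longlonglongrightarrow> 1 / 2 + (2 * ?r - 1) / (2 * real d)"
    using frac_mean_rational[of d c "\<rho> - lam * t0"] cd by simp
  moreover have "(1 / 2 + (2 * ?r - 1) / (2 * real d)) / lam =
      1 / (2 * lam) + (2 * ?r - 1) / (2 * real d * lam)"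
    by (simp add: add_divide_distrib)
  ultimately show "optimal_average_age Pr {..<q} q lam mu t0 U E =
      ereal (1 / (2 * lam) + (2 * ?r - 1) / (2 * real d * lam) + (1 + \<epsilon>) / (2 * mu * (1 - \<epsilon>)))"
    using opt by simp
qed

end
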